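(* Let $m\ge 4$ and let $C=C_1\cup\dots\cup C_m\subset\mathbb{P}^2$ be a normal crossing divisor whose irreducible components $C_j:f_j=0$ are smooth curves of degree $e_j$; let $f=f_1\cdots f_m$ and $d=\deg f=e_1+\dots+e_m$. Assume that exactly one component of $C$ is a line and that $f_1=x$ (so $e_j\ge 2$ for $j\ge 2$). Then the minimal graded free resolution of the graded $S$-module $D_0(f)$ has the shape $$0\to\bigoplus_{j=2}^{m}S(-d+2-e_j)\to S(-d+2)^{m-1}\oplus S(-d+1)^2\ (\to D_0(f)\to 0),$$ and hence the minimal graded free resolution of the Jacobian algebra $M(f)$ has the shape $$0\to\bigoplus_{j=2}^{m}S(-2d+3-e_j)\to S(-2d+3)^{m-1}\oplus S(-2d+2)^2\to S(-d+1)^3\to S\ (\to M(f)\to 0).$$ Moreover, the $m-1$ generating syzygies $\rho_2,\dots,\rho_m$ of $D_0(f)$ (i.e. the generators of the module of relations among the generators of $D_0(f)$, given by the first map of the first resolution) correspond to the following relations among the 2-forms $\omega_1,\dots,\omega_{m-1},\omega^y,\omega^z$ that generate $D_0(f)$: $$\rho_j:\quad f_j\omega_j-(x f_{j,x}\,\omega_1+f_{j,y}\,\omega^y+f_{j,z}\,\omega^z)=0,\qquad j=2,\dots,m,$$ where for $j=m$ the form $\omega_m$ has to be replaced by $-\sum_{i=1}^{m-1}\omega_i$.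
   Context: $S=\mathbb{C}[x,y,z]$ with its standard grading, and $\mathbb{P}^2$ is the complex projective plane. For $f\in S$ homogeneous with partial derivatives $f_x,f_y,f_z$, the Jacobian ideal is $J_f=(f_x,f_y,f_z)$, the Jacobian (Milnor) algebra is $M(f)=S/J_f$, and the graded module of Jacobian syzygies is $D_0(f)=\{(a,b,c)\in S^3: af_x+bf_y+cf_z=0\}$; a homogeneous syzygy $(a,b,c)$ has degree equal to the common degree of $a,b,c$. $f_{j,x},f_{j,y},f_{j,z}$ denote the partial derivatives of $f_j$. $\Omega^j$ is the $S$-module of polynomial differential $j$-forms on $\mathbb{C}^3$. A triple $(a,b,c)\in S^3$ is identified with the 2-form $a\,dy\wedge dz-b\,dx\wedge dz+c\,dx\wedge dy$; under this identification $D_0(f)$ corresponds to the 2-forms $\omega$ with $df\wedge\omega=0$. Define $\omega^y=df\wedge dy$, $\omega^z=df\wedge dz$, and for $j=1,\dots,m$ $$\omega_j=df\wedge\frac{df_j}{f_j}=\sum_{1\le i\le m,\ i\ne j}\frac{f}{f_if_j}\,df_i\wedge df_j\in\Omega^2 .$$ These satisfy $\sum_{j=1}^m\omega_j=0$. *)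

theory Defs
  imports
    "HOL-Computational_Algebra.Computational_Algebra"
    "HOL-Computational_Algebra.Field_as_Ring"
    "HOL-Library.Product_Plus"
    "HOL-Library.Function_Algebras"
    "HOL-Algebra.QuotRing"
    "HOL-Algebra.Module"
begin

section \<open>The graded ring C[x,y,z]\<close>

text \<open>
  Iterated univariate polynomials: the outermost variable is x, the innermost is z, so the
  coefficient of \<open>x^i y^j z^k\<close> in \<open>p\<close> is \<open>coeff (coeff (coeff p i) j) k\<close>.
\<close>

type_synonym poly3 = "complex poly poly poly"

definition X :: poly3 where "X = [:0, 1:]"
definition Y :: poly3 where "Y = [:[:0, 1:]:]"
definition Z :: poly3 where "Z = [:[:[:0, 1:]:]:]"

definition coeff3 :: "poly3 \<Rightarrow> nat \<Rightarrow> nat \<Rightarrow> nat \<Rightarrow> complex" where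
  "coeff3 p i j k = coeff (coeff (coeff p i) j) k"

definition eval3 :: "poly3 \<Rightarrow> complex \<times> complex \<times> complex \<Rightarrow> complex" where
  "eval3 p = (\<lambda>(a, b, c). poly (poly (poly p [:[:a:]:]) [:b:]) c)"

definition dx :: "poly3 \<Rightarrow> poly3" where "dx = pderiv"
definition dy :: "poly3 \<Rightarrow> poly3" where "dy = map_poly pderiv"
definition dz :: "poly3 \<Rightarrow> poly3" where "dz = map_poly (map_poly pderiv)"

definition homog_part :: "int \<Rightarrow> poly3 set" where
  "homog_part n = {p. \<forall>i j k. coeff3 p i j k \<noteq> 0 \<longrightarrow> int (i + j + k) = n}"

definition S_ring :: "poly3 ring" where
  "S_ring = \<lparr>carrier = UNIV, mult = (*), one = 1, zero = 0, add = (+)\<rparr>"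

definition irrelevant_ideal :: "poly3 set" where
  "irrelevant_ideal = Idl\<^bsub>S_ring\<^esub> {X, Y, Z}"


section \<open>Plane projective curves\<close>

text \<open>
  A point of the projective plane is given by any of its homogeneous coordinate vectors
  \<open>p \<noteq> 0\<close>; all conditions below are invariant under rescaling \<open>p\<close> when \<open>g\<close> is homogeneous.
\<close>

definition curve :: "poly3 \<Rightarrow> (complex \<times> complex \<times> complex) set" where
  "curve g = {p. p \<noteq> 0 \<and> eval3 g p = 0}"

definition smooth_curve :: "poly3 \<Rightarrow> bool" where
  "smooth_curve g \<longleftrightarrow>
     (\<forall>p\<in>curve g. (eval3 (dx g) p, eval3 (dy g) p, eval3 (dz g) p) \<noteq> (0, 0, 0))"

definition tangent_line ::
    "poly3 \<Rightarrow> complex \<times> complex \<times> complex \<Rightarrow> (complex \<times> complex \<times> complex) set" where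
  "tangent_line g p =
     {(u, v, w). eval3 (dx g) p * u + eval3 (dy g) p * v + eval3 (dz g) p * w = 0}"

text \<open>
  Normal crossings, for a family of smooth curves: through every point pass at most two of the
  curves, and two curves through a common point meet there transversally.
\<close>

definition normal_crossing :: "nat set \<Rightarrow> (nat \<Rightarrow> poly3) \<Rightarrow> bool" where
  "normal_crossing I f \<longleftrightarrow>
     (\<forall>p. card {i \<in> I. p \<in> curve (f i)} \<le> 2) \<and>
     (\<forall>i\<in>I. \<forall>j\<in>I. i \<noteq> j \<longrightarrow>
        (\<forall>p \<in> curve (f i) \<inter> curve (f j). tangent_line (f i) p \<noteq> tangent_line (f j) p))"


section \<open>Differential forms\<close>

text \<open>
  A triple \<open>(p, q, r)\<close> stands for the 1-form \<open>p dx + q dy + r dz\<close>, and a triple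
  \<open>(a, b, c)\<close> for the 2-form \<open>a dy\<and>dz - b dx\<and>dz + c dx\<and>dy\<close>. The sign convention for
  2-forms explains the middle component of \<open>wedge\<close>.
\<close>

type_synonym form1 = "poly3 \<times> poly3 \<times> poly3"
type_synonym form2 = "poly3 \<times> poly3 \<times> poly3"

definition ext_d :: "poly3 \<Rightarrow> form1" where
  "ext_d g = (dx g, dy g, dz g)"

definition wedge :: "form1 \<Rightarrow> form1 \<Rightarrow> form2" where
  "wedge = (\<lambda>(p, q, r) (p', q', r').
     (q * r' - r * q', - (p * r' - r * p'), p * q' - q * p'))"

definition form_smult :: "poly3 \<Rightarrow> form2 \<Rightarrow> form2" where
  "form_smult s = (\<lambda>(a, b, c). (s * a, s * b, s * c))"

text \<open>\<open>omega m f j\<close> is \<open>df \<and> df_j / f_j\<close> for \<open>f = f_1 \<cdots> f_m\<close>, with the denominator cleared.\<close>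

definition omega :: "nat \<Rightarrow> (nat \<Rightarrow> poly3) \<Rightarrow> nat \<Rightarrow> form2" where
  "omega m f j = (\<Sum>i\<in>{1..m} - {j}.
     form_smult (\<Prod>k\<in>{1..m} - {i, j}. f k) (wedge (ext_d (f i)) (ext_d (f j))))"

definition omega_y :: "poly3 \<Rightarrow> form2" where "omega_y F = wedge (ext_d F) (ext_d Y)"
definition omega_z :: "poly3 \<Rightarrow> form2" where "omega_z F = wedge (ext_d F) (ext_d Z)"


section \<open>Graded modules\<close>

record ('a, 'b) graded_module = "('a, 'b) module" +
  graded_part :: "int \<Rightarrow> 'b set"

text \<open>
  The fields \<open>mult\<close> and \<open>one\<close> are inherited from the record type of rings and play no role for modules.
\<close>

definition D0 :: "poly3 \<Rightarrow> (poly3, poly3 \<times> poly3 \<times> poly3) graded_module" where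
  "D0 f = \<lparr>carrier = {(a, b, c). a * dx f + b * dy f + c * dz f = 0},
     mult = undefined, one = undefined, zero = 0, add = (+),
     smult = form_smult,
     graded_part = (\<lambda>n. {(a, b, c). a * dx f + b * dy f + c * dz f = 0 \<and>
        a \<in> homog_part n \<and> b \<in> homog_part n \<and> c \<in> homog_part n})\<rparr>"

definition jacobian_ideal :: "poly3 \<Rightarrow> poly3 set" where
  "jacobian_ideal f = Idl\<^bsub>S_ring\<^esub> {dx f, dy f, dz f}"

definition milnor_algebra :: "poly3 \<Rightarrow> (poly3, poly3 set) graded_module" where
  "milnor_algebra f = (let J = jacobian_ideal f; Q = S_ring Quot J in
     \<lparr>carrier = carrier Q, mult = mult Q, one = one Q, zero = zero Q, add = add Q,
      smult = (\<lambda>s A. (J +>\<^bsub>S_ring\<^esub> s) \<otimes>\<^bsub>Q\<^esub> A),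
      graded_part = (\<lambda>n. (\<lambda>p. J +>\<^bsub>S_ring\<^esub> p) ` homog_part n)\<rparr>)"

text \<open>
  \<open>free_module [a_0, \<dots>, a_{r-1}]\<close> is \<open>S(a_0) \<oplus> \<dots> \<oplus> S(a_{r-1})\<close>, where \<open>S(a)_n = S_{a+n}\<close>;
  its elements are functions vanishing from \<open>r\<close> on.
\<close>

definition free_module :: "int list \<Rightarrow> (poly3, nat \<Rightarrow> poly3) graded_module" where
  "free_module as = \<lparr>carrier = {v. \<forall>i\<ge>length as. v i = 0},
     mult = undefined, one = undefined, zero = 0, add = (+),
     smult = (\<lambda>s v i. s * v i),
     graded_part = (\<lambda>n. {v. (\<forall>i\<ge>length as. v i = 0) \<and>
        (\<forall>i<length as. v i \<in> homog_part (as ! i + n))})\<rparr>"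

definition unit_vec :: "nat \<Rightarrow> nat \<Rightarrow> poly3" where
  "unit_vec k = (\<lambda>i. if i = k then 1 else 0)"

definition vec_smult :: "poly3 \<Rightarrow> (nat \<Rightarrow> poly3) \<Rightarrow> nat \<Rightarrow> poly3" where
  "vec_smult s v = (\<lambda>i. s * v i)"

definition graded_hom ::
    "(poly3, 'm) graded_module \<Rightarrow> (poly3, 'n) graded_module \<Rightarrow> ('m \<Rightarrow> 'n) \<Rightarrow> bool" where
  "graded_hom M N \<phi> \<longleftrightarrow>
     \<phi> \<in> carrier M \<rightarrow> carrier N \<and>
     (\<forall>v\<in>carrier M. \<forall>w\<in>carrier M. \<phi> (v \<oplus>\<^bsub>M\<^esub> w) = \<phi> v \<oplus>\<^bsub>N\<^esub> \<phi> w) \<and>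
     (\<forall>s. \<forall>v\<in>carrier M. \<phi> (s \<odot>\<^bsub>M\<^esub> v) = s \<odot>\<^bsub>N\<^esub> \<phi> v) \<and>
     (\<forall>n. \<phi> ` graded_part M n \<subseteq> graded_part N n)"

definition ker_on ::
    "(poly3, 'm) graded_module \<Rightarrow> (poly3, 'n) graded_module \<Rightarrow> ('m \<Rightarrow> 'n) \<Rightarrow> 'm set" where
  "ker_on M N \<phi> = {v \<in> carrier M. \<phi> v = \<zero>\<^bsub>N\<^esub>}"


section \<open>Minimal graded free resolutions\<close>

text \<open>
  A finite resolution \<open>0 \<rightarrow> F_n \<rightarrow> \<dots> \<rightarrow> F_0 \<rightarrow> M \<rightarrow> 0\<close> is given by the list of the twist lists of
  \<open>F_0, \<dots>, F_n\<close>, extended by zero modules, by the augmentation \<open>\<epsilon> : F_0 \<rightarrow> M\<close> and by the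
  differentials \<open>\<delta> i : F_{i+1} \<rightarrow> F_i\<close>.
\<close>

definition res_term :: "int list list \<Rightarrow> nat \<Rightarrow> (poly3, nat \<Rightarrow> poly3) graded_module" where
  "res_term Fs i = free_module (if i < length Fs then Fs ! i else [])"

definition graded_free_resolution ::
    "(poly3, 'm) graded_module \<Rightarrow> int list list \<Rightarrow> ((nat \<Rightarrow> poly3) \<Rightarrow> 'm) \<Rightarrow>
     (nat \<Rightarrow> (nat \<Rightarrow> poly3) \<Rightarrow> (nat \<Rightarrow> poly3)) \<Rightarrow> bool" where
  "graded_free_resolution M Fs \<epsilon> \<delta> \<longleftrightarrow>
     graded_hom (res_term Fs 0) M \<epsilon> \<and>
     (\<forall>i. graded_hom (res_term Fs (Suc i)) (res_term Fs i) (\<delta> i)) \<and>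
     \<epsilon> ` carrier (res_term Fs 0) = carrier M \<and>
     ker_on (res_term Fs 0) M \<epsilon> = \<delta> 0 ` carrier (res_term Fs 1) \<and>
     (\<forall>i. ker_on (res_term Fs (Suc i)) (res_term Fs i) (\<delta> i)
            = \<delta> (Suc i) ` carrier (res_term Fs (Suc (Suc i))))"

text \<open>Minimality means that the image of every differential lies in \<open>(x, y, z) F_i\<close>.\<close>

definition minimal_graded_free_resolution ::
    "(poly3, 'm) graded_module \<Rightarrow> int list list \<Rightarrow> ((nat \<Rightarrow> poly3) \<Rightarrow> 'm) \<Rightarrow>
     (nat \<Rightarrow> (nat \<Rightarrow> poly3) \<Rightarrow> (nat \<Rightarrow> poly3)) \<Rightarrow> bool" where
  "minimal_graded_free_resolution M Fs \<epsilon> \<delta> \<longleftrightarrow>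
     graded_free_resolution M Fs \<epsilon> \<delta> \<and>
     (\<forall>i. \<forall>v\<in>carrier (res_term Fs (Suc i)). \<forall>k. \<delta> i v k \<in> irrelevant_ideal)"


section \<open>The relations among the generators\<close>

text \<open>
  In the free module on the generators \<open>\<omega>_1, \<dots>, \<omega>_{m-1}, \<omega>^y, \<omega>^z\<close>, in this order, these
  correspond to the unit vectors number \<open>0, \<dots>, m - 2\<close>, \<open>m - 1\<close> and \<open>m\<close>. In both definitions
  the \<open>m\<close>-th form is expressed through the others by \<open>\<omega>_m = - (\<omega>_1 + \<dots> + \<omega>_{m-1})\<close>.
\<close>

definition omega_subst :: "nat \<Rightarrow> (nat \<Rightarrow> poly3) \<Rightarrow> nat \<Rightarrow> form2" where
  "omega_subst m f j = (if j = m then - (\<Sum>i\<in>{1..m - 1}. omega m f i) else omega m f j)"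

definition gen_vec :: "nat \<Rightarrow> nat \<Rightarrow> nat \<Rightarrow> poly3" where
  "gen_vec m j = (if j = m then - (\<Sum>i\<in>{1..m - 1}. unit_vec (i - 1)) else unit_vec (j - 1))"

definition rho :: "nat \<Rightarrow> (nat \<Rightarrow> poly3) \<Rightarrow> nat \<Rightarrow> nat \<Rightarrow> poly3" where
  "rho m f j = vec_smult (f j) (gen_vec m j)
     - (vec_smult (X * dx (f j)) (gen_vec m 1)
        + vec_smult (dy (f j)) (unit_vec (m - 1))
        + vec_smult (dz (f j)) (unit_vec m))"

end

theory Submission
  imports Defs "HOL-Analysis.Continuum_Not_Denumerable"
begin

text \<open>
  Write \<open>F = f_1 \<cdots> f_m\<close>, of degree \<open>d\<close>, and read \<open>D_0(F)\<close> as the module of 2-forms \<open>\<theta>\<close> with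
  \<open>dF \<and> \<theta> = 0\<close>. Let \<open>W\<close> be the submodule spanned by \<open>\<omega>_1, \<dots>, \<omega>_{m-1}, \<omega>^y, \<omega>^z\<close>. It contains
  \<open>\<omega>_m = - \<Sum> \<omega>_i\<close> and, because \<open>x \<omega>_1 = dF \<and> dx\<close>, every form \<open>dF \<and> \<gamma>\<close>. Three things have to be
  shown: the relations of these generators are spanned by the \<open>\<rho>_j\<close>, the \<open>\<rho>_j\<close> are independent,
  and \<open>W = D_0(F)\<close>.

  Relations (\<open>relations\<close>, \<open>del_inj\<close>). A relation among the generators says \<open>dF \<and> \<alpha> = 0\<close> for
  \<open>\<alpha> = \<Sum> v_j df_j/f_j + v_y dy + v_z dz\<close>. Contraction with the Euler field gives
  \<open>\<alpha> = \<lambda> dF/F\<close>, where \<open>\<lambda> = (\<Sum> e_j v_j + y v_y + z v_z)/d\<close> is a polynomial. As \<open>dF/F = \<Sum> df_j/f_j\<close>, clearing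
  denominators shows that \<open>f_j\<close> divides \<open>v_j - \<lambda>\<close>, and the quotients are the coefficients of the
  given relation with respect to the \<open>\<rho>_j\<close>. Independence is the same contraction once more.

  Generators (\<open>generators\<close>). So \<open>W\<close> has a free resolution of length one. As \<open>x, y, z\<close> is a regular
  sequence of length three, a diagram chase (\<open>saturated_of_resolution\<close>) shows that no nonzero element
  of \<open>D_0(F)/W\<close> is killed by \<open>x\<close>, \<open>y\<close> and \<open>z\<close>. On the other hand \<open>D_0(F)/W\<close> is killed by the partial
  derivatives of \<open>F\<close> and, by Cramer's rule, by the coefficients of all the \<open>\<omega>_i\<close>
  (\<open>omega_annihilates\<close>). These polynomials have no common zero except the origin: away from the
  nodes of the curve some partial derivative of \<open>F\<close> does not vanish, and at a node of \<open>C_i \<union> C_j\<close> the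
  form \<open>\<omega>_i\<close> is a nonzero multiple of \<open>df_j \<and> df_i\<close>, which is nonzero by transversality. By the
  \<open>Nullstellensatz\<close> every element of \<open>D_0(F)/W\<close> is then killed by powers of \<open>x\<close>, \<open>y\<close> and \<open>z\<close>; multiplying a
  nonzero element by the highest powers that do not kill it contradicts the previous statement.

  Splicing the resolution of \<open>D_0(F)\<close> with \<open>S^3 \<rightarrow> S \<rightarrow> M(F)\<close> gives the resolution of the Jacobian algebra.
  The gradings are a count of degrees, and the resolutions are minimal because the entries of all
  matrices are homogeneous of positive degree or zero; for \<open>\<partial>f_j/\<partial>y\<close> and \<open>\<partial>f_j/\<partial>z\<close>, with \<open>j \<ge> 2\<close>, this is
  where \<open>e_j \<ge> 2\<close> enters.
\<close>

section \<open>Polynomials in three variables\<close>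

lemma coeff3_eqI: "(\<And>i j k. coeff3 p i j k = coeff3 q i j k) \<Longrightarrow> p = q"
  unfolding coeff3_def by (intro poly_eqI) auto

lemma coeff3_0 [simp]: "coeff3 0 i j k = 0"
  and coeff3_add: "coeff3 (p + q) i j k = coeff3 p i j k + coeff3 q i j k"
  and coeff3_uminus: "coeff3 (- p) i j k = - coeff3 p i j k"
  and coeff3_of_nat: "coeff3 (of_nat n * p) i j k = of_nat n * coeff3 p i j k"
  by (simp_all add: coeff3_def of_nat_poly)

lemma coeff3_X: "coeff3 (X * p) i j k = (case i of 0 \<Rightarrow> 0 | Suc i' \<Rightarrow> coeff3 p i' j k)"
  and coeff3_Y: "coeff3 (Y * p) i j k = (case j of 0 \<Rightarrow> 0 | Suc j' \<Rightarrow> coeff3 p i j' k)"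
  and coeff3_Z: "coeff3 (Z * p) i j k = (case k of 0 \<Rightarrow> 0 | Suc k' \<Rightarrow> coeff3 p i j k')"
  by (simp_all add: coeff3_def X_def Y_def Z_def coeff_pCons split: nat.split)

lemma coeff3_dx: "coeff3 (dx p) i j k = of_nat (Suc i) * coeff3 p (Suc i) j k"
  and coeff3_dy: "coeff3 (dy p) i j k = of_nat (Suc j) * coeff3 p i (Suc j) k"
  and coeff3_dz: "coeff3 (dz p) i j k = of_nat (Suc k) * coeff3 p i j (Suc k)"
  by (simp_all only: coeff3_def dx_def dy_def dz_def coeff_map_poly coeff_pderiv pderiv_0
      map_poly_0 of_nat_poly mult_pCons_left mult_zero_left smult_conv_map_poly
      pCons_0_0 add_0_right mult_zero_right if_True coeff_smult refl
      flip: smult_conv_map_poly)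

lemma coeff3_mult:
  "coeff3 (p * q) i j k =
     (\<Sum>a\<le>i. \<Sum>b\<le>j. \<Sum>c\<le>k. coeff3 p a b c * coeff3 q (i - a) (j - b) (k - c))"
  by (simp add: coeff3_def coeff_mult coeff_sum)

lemma eval3_0 [simp]: "eval3 0 a = 0"
  and eval3_1 [simp]: "eval3 1 a = 1"
  and eval3_add: "eval3 (p + q) a = eval3 p a + eval3 q a"
  and eval3_diff: "eval3 (p - q) a = eval3 p a - eval3 q a"
  and eval3_uminus: "eval3 (- p) a = - eval3 p a"
  and eval3_mult: "eval3 (p * q) a = eval3 p a * eval3 q a"
  by (simp_all add: eval3_def split: prod.split)

lemma eval3_sum: "eval3 (\<Sum>i\<in>A. g i) a = (\<Sum>i\<in>A. eval3 (g i) a)"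
  by (induction A rule: infinite_finite_induct) (auto simp: eval3_add)

lemma eval3_prod: "eval3 (\<Prod>i\<in>A. g i) a = (\<Prod>i\<in>A. eval3 (g i) a)"
  by (induction A rule: infinite_finite_induct) (auto simp: eval3_mult)

lemma eval3_of_nat: "eval3 (of_nat n) a = of_nat n"
  by (induction n) (auto simp: eval3_add)

lemma eval3_XYZ:
  "eval3 X (a, b, c) = a" "eval3 Y (a, b, c) = b" "eval3 Z (a, b, c) = c"
  by (simp_all add: eval3_def X_def Y_def Z_def)

subsection \<open>Derivations\<close>

locale derivation =
  fixes D :: "'a::comm_ring_1 \<Rightarrow> 'a"
  assumes add: "D (a + b) = D a + D b"
    and mult: "D (a * b) = D a * b + a * D b"
begin

lemma zero: "D 0 = 0"
  using add[of 0 0] by simp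

lemma one: "D 1 = 0"
  using mult[of 1 1] by simp

lemma sum: "D (\<Sum>i\<in>A. g i) = (\<Sum>i\<in>A. D (g i))"
  by (induction A rule: infinite_finite_induct) (auto simp: zero add)

lemma prod: "finite A \<Longrightarrow> D (\<Prod>i\<in>A. g i) = (\<Sum>i\<in>A. (\<Prod>k\<in>A - {i}. g k) * D (g i))"
proof (induction A rule: finite_induct)
  case (insert a A)
  have "(\<Sum>i\<in>A. (\<Prod>k\<in>insert a A - {i}. g k) * D (g i)) =
        (\<Sum>i\<in>A. g a * ((\<Prod>k\<in>A - {i}. g k) * D (g i)))"
  proof (rule sum.cong[OF refl])
    fix i assume "i \<in> A"
    then have "insert a A - {i} = insert a (A - {i})" using insert by auto
    then show "(\<Prod>k\<in>insert a A - {i}. g k) * D (g i) = g a * ((\<Prod>k\<in>A - {i}. g k) * D (g i))"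
      using insert by (simp add: ac_simps)
  qed
  then show ?case using insert by (simp add: mult sum_distrib_left ac_simps)
qed (simp add: one)

lemma map_poly: "derivation (map_poly D)"
proof
  fix p q
  show "map_poly D (p + q) = map_poly D p + map_poly D q"
    by (rule poly_eqI) (simp add: coeff_map_poly zero add)
  show "map_poly D (p * q) = map_poly D p * q + p * map_poly D q"
    by (rule poly_eqI) (simp add: coeff_map_poly zero coeff_mult sum mult sum.distrib)
qed

end

lemma derivation_pderiv: "derivation (pderiv :: 'a::idom poly \<Rightarrow> 'a poly)"
  by unfold_locales (simp_all add: pderiv_add pderiv_mult algebra_simps)

interpretation dx: derivation dx
  unfolding dx_def by (rule derivation_pderiv)

interpretation dy: derivation dy
  unfolding dy_def by (intro derivation.map_poly derivation_pderiv)

interpretation dz: derivation dz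
  unfolding dz_def by (intro derivation.map_poly derivation_pderiv)

lemma d_XYZ [simp]:
  "dx X = 1" "dy X = 0" "dz X = 0"
  "dx Y = 0" "dy Y = 1" "dz Y = 0"
  "dx Z = 0" "dy Z = 0" "dz Z = 1"
  by (simp_all add: dx_def dy_def dz_def X_def Y_def Z_def map_poly_pCons pderiv_pCons pderiv_0 one_pCons)

text \<open>
  A polynomial that divides its derivative with respect to some variable does not involve that
  variable, by comparing degrees; applied to all three variables this leaves a constant.
\<close>

lemma not_dvd_partials:
  assumes "g dvd dx g" "g dvd dy g" "g dvd dz g"
  shows "is_unit g \<or> g = 0"
proof -
  have "degree g = 0" using assms(1) by (simp add: dx_def)
  then obtain h where h: "g = [:h:]" by (metis degree_eq_zeroE)
  have "h dvd pderiv h" using assms(2) by (simp add: dy_def h map_poly_pCons const_poly_dvd_const_poly_iff)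
  then have "degree h = 0" by simp
  then obtain l where l: "h = [:l:]" by (metis degree_eq_zeroE)
  have "[:l:] dvd [:pderiv l:]" using assms(3) 
    by (simp add: dz_def h l map_poly_pCons const_poly_dvd_const_poly_iff)
  then have "degree l = 0" by (simp add: const_poly_dvd_const_poly_iff)
  then obtain c where c: "l = [:c:]" by (metis degree_eq_zeroE)
  show ?thesis
    by (cases "c = 0") (auto simp: h l c is_unit_const_poly_iff dvd_field_iff)
qed

subsection \<open>Homogeneous polynomials\<close>

lemma homog_0 [simp]: "0 \<in> homog_part n"
  by (simp add: homog_part_def)

lemma homog_add: "p \<in> homog_part n \<Longrightarrow> q \<in> homog_part n \<Longrightarrow> p + q \<in> homog_part n"
  by (simp add: homog_part_def coeff3_add) (metis add_0)

lemma homog_uminus: "p \<in> homog_part n \<Longrightarrow> - p \<in> homog_part n"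
  by (simp add: homog_part_def coeff3_uminus)

lemma homog_diff: "p \<in> homog_part n \<Longrightarrow> q \<in> homog_part n \<Longrightarrow> p - q \<in> homog_part n"
  using homog_add[of p n "- q"] homog_uminus by simp

lemma homog_sum: "(\<And>i. i \<in> A \<Longrightarrow> g i \<in> homog_part n) \<Longrightarrow> (\<Sum>i\<in>A. g i) \<in> homog_part n"
  by (induction A rule: infinite_finite_induct) (auto simp: homog_add)

lemma homog_mult:
  assumes "p \<in> homog_part a" "q \<in> homog_part b"
  shows "p * q \<in> homog_part (a + b)"
  unfolding homog_part_def
proof (clarify)
  fix i j k assume nz: "coeff3 (p * q) i j k \<noteq> 0"
  then obtain u v w where uvw: "u \<le> i" "v \<le> j" "w \<le> k"
    "coeff3 p u v w * coeff3 q (i - u) (j - v) (k - w) \<noteq> 0"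
    unfolding coeff3_mult by (auto elim!: sum.not_neutral_contains_not_neutral)
  then have "coeff3 p u v w \<noteq> 0" "coeff3 q (i - u) (j - v) (k - w) \<noteq> 0"
    by auto
  then have "int (u + v + w) = a" "int ((i - u) + (j - v) + (k - w)) = b"
    using assms unfolding homog_part_def by blast+
  then show "int (i + j + k) = a + b" using uvw by linarith
qed

lemma homog_1: "1 \<in> homog_part 0"
  by (auto simp: homog_part_def coeff3_def coeff_pCons one_pCons split: nat.splits)

lemma homog_prod:
  assumes "\<And>i. i \<in> A \<Longrightarrow> g i \<in> homog_part (a i)"
  shows "(\<Prod>i\<in>A. g i) \<in> homog_part (\<Sum>i\<in>A. a i)"
  using assms
  by (induction A rule: infinite_finite_induct) (auto simp: homog_1 intro!: homog_mult)

lemma homog_X: "X \<in> homog_part 1"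
  by (auto simp: homog_part_def coeff3_def X_def coeff_pCons one_pCons split: nat.splits)

lemma homog_dx: "p \<in> homog_part n \<Longrightarrow> dx p \<in> homog_part (n - 1)"
  and homog_dy: "p \<in> homog_part n \<Longrightarrow> dy p \<in> homog_part (n - 1)"
  and homog_dz: "p \<in> homog_part n \<Longrightarrow> dz p \<in> homog_part (n - 1)"
  by (force simp: homog_part_def coeff3_dx coeff3_dy coeff3_dz)+

lemma homog_degree_unique:
  assumes "p \<in> homog_part a" "p \<in> homog_part b" "p \<noteq> 0"
  shows "a = b"
proof -
  obtain i j k where "coeff3 p i j k \<noteq> 0"
    using assms(3) coeff3_eqI[of p 0] by auto
  then show ?thesis using assms by (force simp: homog_part_def)
qed

lemma Euler:
  assumes "g \<in> homog_part (int n)"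
  shows "X * dx g + Y * dy g + Z * dz g = of_nat n * g"
proof (rule coeff3_eqI)
  fix i j k
  have "coeff3 g i j k \<noteq> 0 \<Longrightarrow> n = i + j + k"
    using assms unfolding homog_part_def by fastforce
  then show "coeff3 (X * dx g + Y * dy g + Z * dz g) i j k = coeff3 (of_nat n * g) i j k"
    unfolding coeff3_add coeff3_X coeff3_Y coeff3_Z coeff3_dx coeff3_dy coeff3_dz coeff3_of_nat
    by (cases "coeff3 g i j k = 0") (auto simp: algebra_simps split: nat.split)
qed

text \<open>
  This excludes components of degree zero, since an irreducible polynomial is not a unit.
\<close>

lemma homog_0_unit:
  assumes "g \<in> homog_part 0" "g \<noteq> 0"
  shows "is_unit g"
proof -
  have "g = [:[:[:coeff3 g 0 0 0:]:]:]"
    using assms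
    by (intro coeff3_eqI) (force simp: coeff3_def homog_part_def coeff_pCons split: nat.split)
  then show ?thesis using assms(2)
    by (metis is_unit_const_poly_iff pCons_0_0 dvd_field_iff)
qed

section \<open>The Nullstellensatz\<close>

lemma cring_S_ring: "cring S_ring"
proof (rule cringI)
  show "abelian_group S_ring"
  proof (rule abelian_groupI)
    fix x assume "x \<in> carrier S_ring"
    show "\<exists>y\<in>carrier S_ring. y \<oplus>\<^bsub>S_ring\<^esub> x = \<zero>\<^bsub>S_ring\<^esub>"
      by (rule bexI[of _ "- x"]) (auto simp: S_ring_def)
  qed (auto simp: S_ring_def)
  show "comm_monoid S_ring"
    by (rule comm_monoidI) (auto simp: S_ring_def)
qed (auto simp: S_ring_def algebra_simps)

lemma S_ring_simps [simp]:
  "carrier S_ring = UNIV" "x \<otimes>\<^bsub>S_ring\<^esub> y = x * y" "x \<oplus>\<^bsub>S_ring\<^esub> y = x + y"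
  "\<zero>\<^bsub>S_ring\<^esub> = 0" "\<one>\<^bsub>S_ring\<^esub> = 1"
  by (simp_all add: S_ring_def)

lemma ideal_S_ring_iff:
  "ideal J S_ring \<longleftrightarrow> 0 \<in> J \<and> (\<forall>a\<in>J. \<forall>b\<in>J. a + b \<in> J) \<and> (\<forall>r. \<forall>a\<in>J. r * a \<in> J)"
    (is "_ \<longleftrightarrow> ?R")
proof
  interpret S: cring S_ring by (rule cring_S_ring)
  assume "ideal J S_ring"
  then interpret ideal J S_ring .
  show ?R
    using additive_subgroup.zero_closed[OF is_additive_subgroup]
      additive_subgroup.a_closed[OF is_additive_subgroup] I_l_closed
    by auto
next
  interpret S: cring S_ring by (rule cring_S_ring)
  assume R: ?R
  then have neg: "a \<in> J \<Longrightarrow> - a \<in> J" for a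
    using R[THEN conjunct2, THEN conjunct2, rule_format, of a "- 1"] by simp
  show "ideal J S_ring"
  proof (rule idealI)
    show "subgroup J (add_monoid S_ring)"
    proof (rule S.add.subgroupI)
      fix a assume "a \<in> J"
      moreover have "\<ominus>\<^bsub>S_ring\<^esub> a = - a"
        by (rule S.minus_equality) auto
      ultimately show "\<ominus>\<^bsub>S_ring\<^esub> a \<in> J" using neg by simp
    qed (use R in auto)
  next
    fix a x assume "a \<in> J"
    then have "x * a \<in> J" using R by blast
    then show "x \<otimes>\<^bsub>S_ring\<^esub> a \<in> J" "a \<otimes>\<^bsub>S_ring\<^esub> x \<in> J"
      by (simp_all add: mult.commute)
  qed (rule S.ring_axioms)
qed

lemma
  assumes "ideal J S_ring"
  shows ideal_0: "0 \<in> J"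
    and ideal_add: "a \<in> J \<Longrightarrow> b \<in> J \<Longrightarrow> a + b \<in> J"
    and ideal_mult: "a \<in> J \<Longrightarrow> r * a \<in> J"
  using assms by (auto simp: ideal_S_ring_iff)

lemma ideal_diff: "ideal J S_ring \<Longrightarrow> a \<in> J \<Longrightarrow> b \<in> J \<Longrightarrow> a - b \<in> J"
  using ideal_add[of J a "- b"] ideal_mult[of J b "-1"] by simp

lemma ideal_sum: "ideal J S_ring \<Longrightarrow> (\<And>i. i \<in> A \<Longrightarrow> g i \<in> J) \<Longrightarrow> (\<Sum>i\<in>A. g i) \<in> J"
  by (induction A rule: infinite_finite_induct) (auto simp: ideal_0 ideal_add)

text \<open>
  The ideal \<open>P\<close> is a maximal one among those that contain \<open>J\<close> and no power of \<open>g\<close>. The last property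
  says that every \<open>s \<notin> P\<close> becomes invertible modulo \<open>P\<close> after inverting \<open>g\<close>.
\<close>

lemma ideal_avoiding_powers:
  assumes "ideal J S_ring" "\<And>n. g ^ n \<notin> J"
  obtains P where "ideal P S_ring" "J \<subseteq> P" "\<And>n. g ^ n \<notin> P"
    "\<And>s. s \<notin> P \<Longrightarrow> \<exists>n q. g ^ n - s * q \<in> P"
proof -
  define \<A> where "\<A> = {K. ideal K S_ring \<and> J \<subseteq> K \<and> (\<forall>n. g ^ n \<notin> K)}"
  have "\<exists>M\<in>\<A>. \<forall>K\<in>\<A>. M \<subseteq> K \<longrightarrow> K = M"
  proof (rule subset_Zorn_nonempty)
    show "\<A> \<noteq> {}" using assms by (auto simp: \<A>_def)
  next
    fix \<C> assume ne: "\<C> \<noteq> {}" and ch: "subset.chain \<A> \<C>"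
    have sub: "\<C> \<subseteq> \<A>" and lin: "\<And>K L. K \<in> \<C> \<Longrightarrow> L \<in> \<C> \<Longrightarrow> K \<subseteq> L \<or> L \<subseteq> K"
      using ch by (auto simp: subset_chain_def)
    have "a + b \<in> \<Union>\<C>" if ab: "a \<in> \<Union>\<C>" "b \<in> \<Union>\<C>" for a b
    proof -
      obtain K L where KL: "K \<in> \<C>" "a \<in> K" "L \<in> \<C>" "b \<in> L" using ab by blast
      then have "a \<in> K \<and> b \<in> K \<or> a \<in> L \<and> b \<in> L" using lin by blast
      moreover have "ideal K S_ring" "ideal L S_ring" using KL sub by (auto simp: \<A>_def)
      ultimately show ?thesis using KL by (auto intro: ideal_add)
    qed
    moreover have "r * a \<in> \<Union>\<C>" if "a \<in> \<Union>\<C>" for r a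
      using that sub by (auto simp: \<A>_def intro: ideal_mult)
    moreover have "0 \<in> \<Union>\<C>"
      using ne sub by (auto simp: \<A>_def intro: ideal_0)
    ultimately have "ideal (\<Union>\<C>) S_ring" unfolding ideal_S_ring_iff by blast
    then show "\<Union>\<C> \<in> \<A>" using ne sub unfolding \<A>_def by blast
  qed
  then obtain P where P: "P \<in> \<A>" and max: "\<And>K. K \<in> \<A> \<Longrightarrow> P \<subseteq> K \<Longrightarrow> K = P" by blast
  have id: "ideal P S_ring" using P by (simp add: \<A>_def)
  have "\<exists>n q. g ^ n - s * q \<in> P" if s: "s \<notin> P" for s
  proof (rule ccontr)
    assume no: "\<not> ?thesis"
    \<comment> \<open>The ideal generated by \<open>P\<close> and \<open>s\<close>.\<close>
    define K where "K = {a. \<exists>q. a - s * q \<in> P}"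
    have "ideal K S_ring"
      unfolding ideal_S_ring_iff
    proof (intro conjI ballI allI)
      show "0 \<in> K" using ideal_0[OF id] by (auto simp: K_def intro: exI[of _ 0])
    next
      fix a b assume "a \<in> K" "b \<in> K"
      then obtain q q' where "a - s * q \<in> P" "b - s * q' \<in> P" by (auto simp: K_def)
      then have "(a - s * q) + (b - s * q') \<in> P" by (rule ideal_add[OF id])
      then have "(a + b) - s * (q + q') \<in> P" by (simp add: algebra_simps)
      then show "a + b \<in> K" unfolding K_def by blast
    next
      fix r a assume "a \<in> K"
      then obtain q where "a - s * q \<in> P" by (auto simp: K_def)
      then have "r * (a - s * q) \<in> P" by (rule ideal_mult[OF id])
      then have "r * a - s * (r * q) \<in> P" by (simp add: algebra_simps)
      then show "r * a \<in> K" unfolding K_def by blast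
    qed
    moreover have PK: "P \<subseteq> K" by (auto simp: K_def intro: exI[of _ 0])
    moreover have "\<And>n. g ^ n \<notin> K" using no by (auto simp: K_def)
    ultimately have "K \<in> \<A>" using P by (auto simp: \<A>_def)
    then have "K = P" using max PK by blast
    moreover have "s \<in> K" using ideal_0[OF id] by (auto simp: K_def intro: exI[of _ 1])
    ultimately show False using s by blast
  qed
  then show ?thesis using that P by (auto simp: \<A>_def)
qed

definition const3 :: "complex \<Rightarrow> poly3" where "const3 c = [:[:[:c:]:]:]"

lemma const3_0 [simp]: "const3 0 = 0"
  and const3_1 [simp]: "const3 1 = 1"
  and const3_add: "const3 (a + b) = const3 a + const3 b"
  and const3_uminus: "const3 (- a) = - const3 a"
  and const3_mult: "const3 (a * b) = const3 a * const3 b"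
  by (simp_all add: const3_def one_pCons)

lemma const3_sum: "const3 (\<Sum>i\<in>A. g i) = (\<Sum>i\<in>A. const3 (g i))"
  by (induction A rule: infinite_finite_induct) (auto simp: const3_add)

lemma const3_inverse_of_nat: "n \<ge> 1 \<Longrightarrow> const3 (1 / of_nat n) * of_nat n = 1"
proof -
  assume "n \<ge> 1"
  have "of_nat n = const3 (of_nat n)" by (simp add: const3_def of_nat_poly)
  then have "const3 (1 / of_nat n) * of_nat n = const3 (1 / of_nat n * of_nat n)"
    by (simp only: const3_mult)
  then show ?thesis using \<open>n \<ge> 1\<close> by simp
qed

definition eval_poly3 :: "complex poly \<Rightarrow> poly3 \<Rightarrow> poly3" where
  "eval_poly3 R s = poly (map_poly const3 R) s"

lemma eval_poly3_0 [simp]: "eval_poly3 0 s = 0"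
  and eval_poly3_1 [simp]: "eval_poly3 1 s = 1"
  and eval_poly3_linear: "eval_poly3 [:- c, 1:] s = s - const3 c"
  and eval_poly3_const: "eval_poly3 [:c:] s = const3 c"
  by (simp_all add: eval_poly3_def map_poly_pCons const3_uminus)

lemma eval_poly3_add: "eval_poly3 (R + T) s = eval_poly3 R s + eval_poly3 T s"
proof -
  have "map_poly const3 (R + T) = map_poly const3 R + map_poly const3 T"
    by (rule poly_eqI) (simp add: coeff_map_poly const3_add)
  then show ?thesis by (simp add: eval_poly3_def)
qed

lemma eval_poly3_mult: "eval_poly3 (R * T) s = eval_poly3 R s * eval_poly3 T s"
proof -
  have "map_poly const3 (R * T) = map_poly const3 R * map_poly const3 T"
    by (rule poly_eqI) (simp add: coeff_map_poly const3_sum const3_mult coeff_mult)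
  then show ?thesis by (simp add: eval_poly3_def)
qed

lemma eval_poly3_smult: "eval_poly3 (Polynomial.smult a R) s = const3 a * eval_poly3 R s"
  using eval_poly3_mult[of "[:a:]" R s] by (simp add: eval_poly3_const)

lemma eval_poly3_sum: "eval_poly3 (\<Sum>i\<in>A. g i) s = (\<Sum>i\<in>A. eval_poly3 (g i) s)"
  by (induction A rule: infinite_finite_induct) (auto simp: eval_poly3_add)

lemma eval_poly3_prod: "eval_poly3 (\<Prod>i\<in>A. g i) s = (\<Prod>i\<in>A. eval_poly3 (g i) s)"
  by (induction A rule: infinite_finite_induct) (auto simp: eval_poly3_mult)

text \<open>
  A polynomial over the complex numbers splits into linear factors, so a root of it modulo a prime
  ideal is congruent to a constant.
\<close>

lemma algebraic_imp_const:
  assumes id: "ideal P S_ring" and one: "1 \<notin> P"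
    and prime: "\<And>a b. a * b \<in> P \<Longrightarrow> a \<in> P \<or> b \<in> P"
    and "R \<noteq> 0" "eval_poly3 R s \<in> P"
  shows "\<exists>c. s - const3 c \<in> P"
  using assms(4,5)
proof (induction "degree R" arbitrary: R rule: less_induct)
  case less
  show ?case
  proof (cases "degree R = 0")
    case True
    then obtain c where c: "R = [:c:]" by (metis degree_eq_zeroE)
    then have "const3 (1 / c) * const3 c \<in> P"
      using less.prems by (intro ideal_mult[OF id]) (simp add: eval_poly3_const)
    moreover have "const3 (1 / c) * const3 c = 1"
      using less.prems c by (simp flip: const3_mult)
    ultimately show ?thesis using one by simp
  next
    case False
    then obtain r where "poly R r = 0"
      by (metis fundamental_theorem_of_algebra constant_degree)
    then have "[:- r, 1:] dvd R" by (simp only: poly_eq_0_iff_dvd)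
    then obtain T where T: "R = [:- r, 1:] * T" by (rule dvdE)
    then have "(s - const3 r) * eval_poly3 T s \<in> P"
      using less.prems by (simp only: eval_poly3_mult eval_poly3_linear)
    then consider "s - const3 r \<in> P" | "eval_poly3 T s \<in> P" using prime by blast
    then show ?thesis
    proof cases
      case 2
      have "T \<noteq> 0" using less.prems T by auto
      then have "degree R = Suc (degree T)" unfolding T by (subst degree_mult_eq) auto
      then show ?thesis using less.hyps[of T] 2 \<open>T \<noteq> 0\<close> by simp
    qed blast
  qed
qed

lemma vector_space_const3: "vector_space (\<lambda>c p. const3 c * p)"
  by unfold_locales (auto simp: const3_add const3_mult algebra_simps)

definition monomials :: "nat \<Rightarrow> poly3 set" where
  "monomials D = (\<lambda>(i, j, k). monom (monom (monom 1 k) j) i) ` ({..D} \<times> {..D} \<times> {..D})"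

lemma exponents_bounded: "\<exists>D. \<forall>i j k. coeff3 p i j k \<noteq> 0 \<longrightarrow> i \<le> D \<and> j \<le> D \<and> k \<le> D"
proof -
  define D1 where "D1 = degree p"
  define D2 where "D2 = (\<Sum>i\<le>D1. degree (coeff p i))"
  define D3 where "D3 = (\<Sum>i\<le>D1. \<Sum>j\<le>D2. degree (coeff (coeff p i) j))"
  have "i \<le> D1 \<and> j \<le> D2 \<and> k \<le> D3" if nz: "coeff3 p i j k \<noteq> 0" for i j k
  proof -
    have i: "i \<le> D1" unfolding D1_def using nz by (intro le_degree) (auto simp: coeff3_def)
    have "j \<le> degree (coeff p i)" using nz by (intro le_degree) (auto simp: coeff3_def)
    also have "\<dots> \<le> D2" unfolding D2_def using i by (intro member_le_sum) auto
    finally have j: "j \<le> D2" .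
    have "k \<le> degree (coeff (coeff p i) j)" using nz by (intro le_degree) (auto simp: coeff3_def)
    also have "\<dots> \<le> (\<Sum>j\<le>D2. degree (coeff (coeff p i) j))"
      using j by (intro member_le_sum) auto
    also have "\<dots> \<le> D3"
      unfolding D3_def using i
      by (intro member_le_sum[of i "{..D1}" "\<lambda>i. \<Sum>j\<le>D2. degree (coeff (coeff p i) j)"]) auto
    finally show ?thesis using i j by auto
  qed
  then show ?thesis by (intro exI[of _ "D1 + D2 + D3"]) (meson le_trans le_add1 le_add2)
qed

lemma in_span_monomials: "\<exists>D. p \<in> module.span (\<lambda>c p. const3 c * p) (monomials D)"
proof -
  interpret V: vector_space "\<lambda>c p. const3 c * p" by (rule vector_space_const3)
  obtain D where D: "\<And>i j k. coeff3 p i j k \<noteq> 0 \<Longrightarrow> i \<le> D \<and> j \<le> D \<and> k \<le> D"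
    using exponents_bounded by blast
  have mon: "const3 c * monom (monom (monom 1 k) j) i = monom (monom (monom c k) j) i" for c i j k
    by (simp add: const3_def smult_monom)
  have "p = (\<Sum>i\<le>D. \<Sum>j\<le>D. \<Sum>k\<le>D. const3 (coeff3 p i j k) * monom (monom (monom 1 k) j) i)"
  proof (rule coeff3_eqI)
    fix a b c
    have "coeff3 (\<Sum>i\<le>D. \<Sum>j\<le>D. \<Sum>k\<le>D. monom (monom (monom (coeff3 p i j k) k) j) i) a b c =
        (\<Sum>i\<le>D. \<Sum>j\<le>D. \<Sum>k\<le>D. if i = a then if j = b then if k = c then coeff3 p i j k else 0 else 0 else 0)"
      unfolding coeff3_def coeff_sum by (intro sum.cong refl) auto
    also have "\<dots> = coeff3 p a b c"
    proof -
      have k: "(\<Sum>k\<le>D. if i = a then if j = b then if k = c then coeff3 p i j k else 0 else 0 else 0) =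
          (if i = a then if j = b then coeff3 p a b c else 0 else 0)" for i j
        using D[of a b c] by auto
      have j: "(\<Sum>j\<le>D. if i = a then if j = b then coeff3 p a b c else 0 else 0) =
          (if i = a then coeff3 p a b c else 0)" for i
        using D[of a b c] by auto
      show ?thesis using D[of a b c] by (auto simp: k j)
    qed
    finally show "coeff3 p a b c =
      coeff3 (\<Sum>i\<le>D. \<Sum>j\<le>D. \<Sum>k\<le>D. const3 (coeff3 p i j k) * monom (monom (monom 1 k) j) i) a b c"
      unfolding mon by simp
  qed
  moreover have "monom (monom (monom 1 k) j) i \<in> monomials D" if "i \<le> D" "j \<le> D" "k \<le> D" for i j k
    using that by (force simp: monomials_def)
  then have "(\<Sum>i\<le>D. \<Sum>j\<le>D. \<Sum>k\<le>D. const3 (coeff3 p i j k) * monom (monom (monom 1 k) j) i)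
      \<in> V.span (monomials D)"
    by (intro V.span_sum V.span_scale V.span_base) auto
  ultimately show ?thesis by metis
qed

text \<open>
  This is the point where the complex numbers are used as an uncountable field. If no \<open>s - c\<close> were
  in \<open>P\<close>, each would have an inverse \<open>q c\<close> modulo \<open>P\<close>, up to a power of \<open>g\<close>. Uncountably many \<open>c\<close> share the
  same power of \<open>g\<close> and the same bound for the exponents in \<open>q c\<close>, so the corresponding \<open>q c\<close> lie in one
  finite-dimensional space. But they are linearly independent, like the partial fractions
  \<open>1/(s - c)\<close>: a linear relation, multiplied by the product of the \<open>s - c\<close>, would be an algebraic equation
  for \<open>s\<close> modulo \<open>P\<close>.
\<close>

lemma congruent_to_constant:
  assumes id: "ideal P S_ring" and g: "\<And>n. g ^ n \<notin> P"
    and inv: "\<And>s. s \<notin> P \<Longrightarrow> \<exists>n q. g ^ n - s * q \<in> P"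
    and prime: "\<And>a b. a * b \<in> P \<Longrightarrow> a \<in> P \<or> b \<in> P"
  shows "\<exists>c. s - const3 c \<in> P"
proof (rule ccontr)
  interpret V: vector_space "\<lambda>c p. const3 c * p" by (rule vector_space_const3)
  assume no: "\<nexists>c. s - const3 c \<in> P"
  then have "\<forall>c. \<exists>n q. g ^ n - (s - const3 c) * q \<in> P" using inv by blast
  then obtain n where "\<forall>c. \<exists>q. g ^ n c - (s - const3 c) * q \<in> P"
    by (rule choice[THEN exE])
  then obtain q where nq: "\<forall>c. g ^ n c - (s - const3 c) * q c \<in> P"
    by (rule choice[THEN exE])
  have "\<forall>c. \<exists>D. q c \<in> V.span (monomials D)"
    using in_span_monomials by blast
  then obtain D where D: "\<forall>c. q c \<in> V.span (monomials (D c))"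
    by (rule choice[THEN exE])
  have "\<exists>N E. uncountable {c. n c = N \<and> D c = E}"
  proof (rule ccontr)
    assume "\<not> ?thesis"
    then have "countable (\<Union>N. \<Union>E. {c. n c = N \<and> D c = E})" by (intro countable_UN) auto
    moreover have "(\<Union>N. \<Union>E. {c. n c = N \<and> D c = E}) = (UNIV :: complex set)" by auto
    ultimately show False using uncountable_UNIV_complex by simp
  qed
  then obtain N E where unc: "uncountable {c. n c = N \<and> D c = E}" by blast
  define A where "A = {c. n c = N \<and> D c = E}"
  have qA: "g ^ N - (s - const3 c) * q c \<in> P" if "c \<in> A" for c
    using nq[rule_format, of c] that by (simp add: A_def)
  have indep: "\<gamma> c0 = 0"
    if B: "finite B" "B \<subseteq> A" and rel: "(\<Sum>c\<in>B. const3 (\<gamma> c) * q c) = 0" and c0: "c0 \<in> B"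
    for B and \<gamma> :: "complex \<Rightarrow> complex" and c0
  proof -
    define L where "L = (\<lambda>C :: complex set. \<Prod>c\<in>C. [:- c, 1:])"
    \<comment> \<open>The equation for \<open>s\<close> that results from clearing the denominators \<open>s - c\<close>.\<close>
    define R where "R = (\<Sum>c\<in>B. [:\<gamma> c:] * L (B - {c}))"
    have L: "eval_poly3 (L C) s = (\<Prod>c\<in>C. s - const3 c)" for C
      by (simp add: L_def eval_poly3_prod eval_poly3_linear)
    have "g ^ N * eval_poly3 R s =
        (\<Sum>c\<in>B. const3 (\<gamma> c) * eval_poly3 (L (B - {c})) s * (g ^ N - (s - const3 c) * q c))"
    proof -
      have "(\<Sum>c\<in>B. const3 (\<gamma> c) * eval_poly3 (L (B - {c})) s * ((s - const3 c) * q c)) =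
          (\<Sum>c\<in>B. eval_poly3 (L B) s * (const3 (\<gamma> c) * q c))"
        by (intro sum.cong refl) (simp add: L prod.remove[OF B(1)] ac_simps)
      also have "\<dots> = 0" by (simp add: rel flip: sum_distrib_left)
      finally show ?thesis
        by (simp add: R_def eval_poly3_sum eval_poly3_smult sum_distrib_left right_diff_distrib sum_subtractf ac_simps)
    qed
    also have "\<dots> \<in> P"
      using qA B by (intro ideal_sum[OF id] ideal_mult[OF id]) auto
    finally have "eval_poly3 R s \<in> P" using prime g by blast
    then have "R = 0"
      using algebraic_imp_const[OF id _ prime] no g[of 0] by auto
    then have "0 = poly R c0" by simp
    also have "\<dots> = (\<Sum>c\<in>B. if c = c0 then \<gamma> c * poly (L (B - {c})) c0 else 0)"
      unfolding R_def poly_sum poly_mult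
    proof (intro sum.cong refl)
      fix c assume "c \<in> B"
      have "poly (L (B - {c})) c0 = 0" if "c \<noteq> c0"
        unfolding L_def poly_prod using B(1) c0 that by (intro prod_zero) auto
      then show "poly [:\<gamma> c:] c0 * poly (L (B - {c})) c0 = (if c = c0 then \<gamma> c * poly (L (B - {c})) c0 else 0)"
        by auto
    qed
    also have "\<dots> = \<gamma> c0 * poly (L (B - {c0})) c0" using B(1) c0 by simp
    finally show "\<gamma> c0 = 0" using B(1) by (auto simp: L_def poly_prod)
  qed
  have inj: "inj_on q A"
  proof (rule inj_onI, rule ccontr)
    fix a b assume ab: "a \<in> A" "b \<in> A" "q a = q b" "a \<noteq> b"
    have "(\<Sum>c\<in>{a, b}. const3 (if c = a then 1 else - 1) * q c) = 0"
      using ab by (simp add: const3_uminus)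
    then have "(if a = a then 1 else - 1 :: complex) = 0"
      using ab by (intro indep[of "{a, b}" "\<lambda>c. if c = a then 1 else - 1" a]) auto
    then show False by simp
  qed
  have "V.independent (q ` A)"
    unfolding V.independent_explicit_finite_subsets
  proof (intro allI impI ballI)
    fix T u v assume T: "T \<subseteq> q ` A" "finite T" "(\<Sum>v\<in>T. const3 (u v) * v) = 0" "v \<in> T"
    then obtain B where B: "B \<subseteq> A" "T = q ` B" by (meson subset_imageE)
    then have injB: "inj_on q B" using inj inj_on_subset by blast
    have "finite B" using T B injB by (simp add: finite_image_iff)
    moreover have "(\<Sum>c\<in>B. const3 (u (q c)) * q c) = 0"
      using T(3) unfolding B by (simp add: sum.reindex[OF injB])
    ultimately show "u v = 0" using indep[of B "u \<circ> q"] B T(4) by auto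
  qed
  moreover have "q ` A \<subseteq> V.span (monomials E)" using D by (auto simp: A_def)
  moreover have "finite (monomials E)" by (simp add: monomials_def)
  ultimately have "finite (q ` A)" using V.independent_span_bound by blast
  then have "finite A" using inj by (simp add: finite_image_iff)
  then show False using unc by (simp add: A_def countable_finite)
qed

lemma congruent_to_value:
  assumes id: "ideal P S_ring"
    and a: "X - const3 a \<in> P" and b: "Y - const3 b \<in> P" and c: "Z - const3 c \<in> P"
  shows "h - const3 (eval3 h (a, b, c)) \<in> P"
proof -
  define h1 where "h1 = poly h [:[:a:]:]"
  define h2 where "h2 = poly h1 [:b:]"
  have rem: "\<exists>q'. p - [:poly p r:] = q' * [:- r, 1:]" for p :: "'a::comm_ring_1 poly" and r
  proof -
    have "poly (p - [:poly p r:]) r = 0" by simp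
    then have "[:- r, 1:] dvd p - [:poly p r:]" by (simp only: poly_eq_0_iff_dvd)
    then obtain q' where "p - [:poly p r:] = [:- r, 1:] * q'" by (rule dvdE)
    then show ?thesis by (intro exI[of _ q']) (simp only: mult.commute)
  qed
  have XYZ: "X - const3 a = [:- [:[:a:]:], 1:]" "Y - const3 b = [:[:- [:b:], 1:]:]"
    "Z - const3 c = [:[:[:- c, 1:]:]:]"
    by (simp_all add: X_def Y_def Z_def const3_def one_pCons)
  have "h - [:h1:] \<in> P"
    using rem[of h "[:[:a:]:]"] ideal_mult[OF id a] unfolding h1_def XYZ by metis
  moreover have "[:h1:] - [:[:h2:]:] \<in> P"
  proof -
    obtain q' where "h1 - [:h2:] = q' * [:- [:b:], 1:]" using rem[of h1 "[:b:]"] by (auto simp: h2_def)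
    then have "[:h1:] - [:[:h2:]:] = [:q':] * [:[:- [:b:], 1:]:]" by simp
    then show ?thesis using ideal_mult[OF id b] unfolding XYZ by metis
  qed
  moreover have "[:[:h2:]:] - const3 (poly h2 c) \<in> P"
  proof -
    obtain q' where "h2 - [:poly h2 c:] = q' * [:- c, 1:]" using rem[of h2 c] by auto
    then have "[:[:h2:]:] - const3 (poly h2 c) = [:[:q':]:] * [:[:[:- c, 1:]:]:]"
      by (simp add: const3_def)
    then show ?thesis using ideal_mult[OF id c] unfolding XYZ by metis
  qed
  ultimately have "(h - [:h1:]) + (([:h1:] - [:[:h2:]:]) + ([:[:h2:]:] - const3 (poly h2 c))) \<in> P"
    by (intro ideal_add[OF id])
  then have "h - const3 (poly h2 c) \<in> P"
    by (simp only: add_diff_eq diff_add_cancel)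
  then show ?thesis by (simp add: h1_def h2_def eval3_def)
qed

text \<open>
  In the residue ring of the ideal from \<open>ideal_avoiding_powers\<close> the three variables are congruent to
  constants; these are the coordinates of a zero of \<open>J\<close> at which \<open>g\<close> does not vanish.
\<close>

theorem Nullstellensatz:
  assumes J: "ideal J S_ring" and van: "\<And>p. (\<And>h. h \<in> J \<Longrightarrow> eval3 h p = 0) \<Longrightarrow> eval3 g p = 0"
  shows "\<exists>n. g ^ n \<in> J"
proof (rule ccontr)
  assume "\<nexists>n. g ^ n \<in> J"
  then obtain P where id: "ideal P S_ring" and JP: "J \<subseteq> P" and g: "\<And>n. g ^ n \<notin> P"
    and inv: "\<And>s. s \<notin> P \<Longrightarrow> \<exists>n q. g ^ n - s * q \<in> P"
    using ideal_avoiding_powers[OF J] by metis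
  have prime: "a \<in> P \<or> b \<in> P" if ab: "a * b \<in> P" for a b
  proof (rule ccontr)
    assume "\<not> ?thesis"
    then obtain n q n' q' where "g ^ n - a * q \<in> P" "g ^ n' - b * q' \<in> P"
      using inv by meson
    then have "g ^ n' * (g ^ n - a * q) + ((a * q) * (g ^ n' - b * q') + (q * q') * (a * b)) \<in> P"
      by (intro ideal_add[OF id] ideal_mult[OF id, OF ab]) (rule ideal_mult[OF id], assumption)+
    then have "g ^ (n + n') \<in> P" by (simp add: algebra_simps power_add)
    then show False using g by blast
  qed
  obtain a b c where abc: "X - const3 a \<in> P" "Y - const3 b \<in> P" "Z - const3 c \<in> P"
    using congruent_to_constant[OF id g inv prime] by meson
  have val: "h - const3 (eval3 h (a, b, c)) \<in> P" for h
    by (rule congruent_to_value[OF id abc])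
  have "eval3 h (a, b, c) = 0" if "h \<in> J" for h
  proof (rule ccontr)
    assume nz: "eval3 h (a, b, c) \<noteq> 0"
    have "h - (h - const3 (eval3 h (a, b, c))) \<in> P"
      using that JP val ideal_diff[OF id] by blast
    then have "const3 (1 / eval3 h (a, b, c)) * const3 (eval3 h (a, b, c)) \<in> P"
      by (intro ideal_mult[OF id]) simp
    then show False using nz g[of 0] by (simp flip: const3_mult)
  qed
  then have "eval3 g (a, b, c) = 0" using van by blast
  then show False using val[of g] g[of 1] by simp
qed

section \<open>Submodules with a free resolution of length one\<close>

lemma X_dvd_iff: "X dvd p \<longleftrightarrow> poly p 0 = 0"
  using poly_eq_0_iff_dvd[of p 0] by (simp add: X_def)

lemma X_neq_0 [simp]: "X \<noteq> 0" and Y_neq_0 [simp]: "Y \<noteq> 0" and Z_neq_0 [simp]: "Z \<noteq> 0"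
  by (simp_all add: X_def Y_def Z_def)

lemma regular_XY:
  assumes "Y * a = X * b"
  shows "\<exists>c. a = X * c"
proof -
  have "poly (Y * a) 0 = poly (X * b) 0" by (simp only: assms)
  then have "poly a 0 = 0" by (simp add: X_def Y_def)
  then show ?thesis by (simp add: dvd_def flip: X_dvd_iff)
qed

text \<open>
  Setting \<open>X = Y = 0\<close> in the hypothesis shows that \<open>a\<close> vanishes there, so \<open>a\<close> lies in the ideal of \<open>X\<close> and \<open>Y\<close>.
\<close>

lemma regular_XYZ:
  assumes "Z * a = Y * b - X * c"
  shows "\<exists>a1 a2. a = Y * a1 - X * a2"
proof -
  have "poly (Z * a) 0 = poly (Y * b - X * c) 0" by (simp only: assms)
  then have *: "[:[:0, 1:]:] * poly a 0 = [:0, 1:] * poly b 0" by (simp add: X_def Y_def Z_def)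
  then have "poly ([:[:0, 1:]:] * poly a 0) 0 = poly ([:0, 1:] * poly b 0) 0" by (simp only:)
  then have "poly (poly a 0) 0 = 0" by simp
  then have "[:0, 1:] dvd poly a 0" using poly_eq_0_iff_dvd[of "poly a 0" 0] by simp
  then obtain q where q: "poly a 0 = [:0, 1:] * q" by (rule dvdE)
  have "poly (a - Y * [:q:]) 0 = 0" by (simp add: q Y_def)
  then have "X dvd a - Y * [:q:]" by (simp only: X_dvd_iff)
  then obtain c where "a - Y * [:q:] = X * c" by (rule dvdE)
  then have "a = Y * [:q:] - X * (- c)" by (simp add: algebra_simps)
  then show ?thesis by blast
qed

text \<open>
  The carrier of a free module of rank \<open>n\<close>, without its grading.
\<close>

definition free_vecs :: "nat \<Rightarrow> (nat \<Rightarrow> poly3) set" where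
  "free_vecs n = {v. \<forall>i\<ge>n. v i = 0}"

lemma vec_smult_apply [simp]: "vec_smult s v i = s * v i"
  by (simp add: vec_smult_def)

lemma regular_XY_vec:
  assumes "vec_smult Y u = vec_smult X w" "u \<in> free_vecs n"
  shows "\<exists>u'\<in>free_vecs n. u = vec_smult X u'"
proof -
  have "\<forall>i. \<exists>c. u i = X * c"
    using fun_cong[OF assms(1)] by (intro allI regular_XY) simp
  then obtain c where c: "\<forall>i. u i = X * c i" by (rule choice[THEN exE])
  then have "u = vec_smult X c" by auto
  moreover have "c i = 0" if "i \<ge> n" for i
    using c[rule_format, of i] assms(2) that by (simp add: free_vecs_def)
  ultimately show ?thesis unfolding free_vecs_def by blast
qed

lemma regular_XYZ_vec:
  assumes "vec_smult Z t = vec_smult Y t' - vec_smult X t''" "t \<in> free_vecs n"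
  shows "\<exists>a\<in>free_vecs n. \<exists>b\<in>free_vecs n. t = vec_smult Y a - vec_smult X b"
proof -
  have "\<exists>p. t i = Y * fst p - X * snd p \<and> (n \<le> i \<longrightarrow> p = 0)" for i
  proof (cases "n \<le> i")
    case True
    then show ?thesis using assms(2) by (intro exI[of _ 0]) (simp add: free_vecs_def)
  next
    case False
    have "Z * t i = Y * t' i - X * t'' i" using fun_cong[OF assms(1), of i] by simp
    from regular_XYZ[OF this] show ?thesis using False by auto
  qed
  then have "\<forall>i. \<exists>p. t i = Y * fst p - X * snd p \<and> (n \<le> i \<longrightarrow> p = 0)" by blast
  then obtain p where p: "\<forall>i. t i = Y * fst (p i) - X * snd (p i) \<and> (n \<le> i \<longrightarrow> p i = 0)"
    by (rule choice[THEN exE])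
  then have "t = vec_smult Y (\<lambda>i. fst (p i)) - vec_smult X (\<lambda>i. snd (p i))" by auto
  moreover have "(\<lambda>i. fst (p i)) \<in> free_vecs n" "(\<lambda>i. snd (p i)) \<in> free_vecs n"
    using p by (auto simp: free_vecs_def)
  ultimately show ?thesis by blast
qed

interpretation vecs: Modules.module vec_smult
  by unfold_locales (auto simp: algebra_simps fun_eq_iff)

interpretation forms: Modules.module form_smult
  by unfold_locales (auto simp: algebra_simps form_smult_def split: prod.split)

lemma free_vecs_subspace: "vecs.subspace (free_vecs n)"
  by (auto simp: vecs.subspace_def free_vecs_def)

text \<open>
  If \<open>0 \<rightarrow> S^a \<rightarrow> S^b \<rightarrow> W \<rightarrow> 0\<close> is exact and \<open>W\<close> is contained in a torsion-free module \<open>M\<close>, then \<open>M/W\<close> has no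
  nonzero element that is killed by all three variables: \<open>W\<close> has depth at least two,
  so that \<open>Ext^1(\<complex>, W) = 0\<close>. Explicitly, the proof lifts the three equations along the resolution. The
  liftings of \<open>X \<theta>\<close>, \<open>Y \<theta>\<close>, \<open>Z \<theta>\<close> are compatible up to elements of \<open>S^a\<close>; these satisfy the Koszul
  relation, because \<open>\<delta>\<close> is injective, and can therefore be removed by correcting the liftings. Then
  the lifting of \<open>X \<theta>\<close> is divisible by \<open>X\<close>.
\<close>

theorem saturated_of_resolution:
  assumes \<delta>: "module_hom vec_smult vec_smult \<delta>" and \<epsilon>: "module_hom vec_smult s \<epsilon>"
    and cod: "\<And>u. u \<in> free_vecs a \<Longrightarrow> \<delta> u \<in> free_vecs b"
    and inj: "\<And>u. u \<in> free_vecs a \<Longrightarrow> \<delta> u = 0 \<Longrightarrow> u = 0"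
    and complex: "\<And>u. u \<in> free_vecs a \<Longrightarrow> \<epsilon> (\<delta> u) = 0"
    and exact: "\<And>v. v \<in> free_vecs b \<Longrightarrow> \<epsilon> v = 0 \<Longrightarrow> v \<in> \<delta> ` free_vecs a"
    and torsion_free: "\<And>\<theta>. s X \<theta> = 0 \<Longrightarrow> \<theta> = 0"
    and \<theta>: "s X \<theta> \<in> \<epsilon> ` free_vecs b" "s Y \<theta> \<in> \<epsilon> ` free_vecs b" "s Z \<theta> \<in> \<epsilon> ` free_vecs b"
  shows "\<theta> \<in> \<epsilon> ` free_vecs b"
proof -
  interpret \<delta>: module_hom vec_smult vec_smult \<delta> by (rule \<delta>)
  interpret \<epsilon>: module_hom vec_smult s \<epsilon> by (rule \<epsilon>)
  note sub = vecs.subspace_diff[OF free_vecs_subspace] vecs.subspace_add[OF free_vecs_subspace]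
    vecs.subspace_scale[OF free_vecs_subspace]
  obtain u1 u2 u3 where u: "u1 \<in> free_vecs b" "u2 \<in> free_vecs b" "u3 \<in> free_vecs b"
    and \<theta>u: "\<epsilon> u1 = s X \<theta>" "\<epsilon> u2 = s Y \<theta>" "\<epsilon> u3 = s Z \<theta>"
    using \<theta> by (auto simp only: image_iff)
  have "\<epsilon> (vec_smult Y u1 - vec_smult X u2) = 0"
    by (simp add: \<epsilon>.diff \<epsilon>.scale \<theta>u mult.commute)
  from exact[OF _ this] obtain t12 where t12: "t12 \<in> free_vecs a" "vec_smult Y u1 - vec_smult X u2 = \<delta> t12"
    by (rule imageE) (auto intro: sub u)
  have "\<epsilon> (vec_smult Z u1 - vec_smult X u3) = 0"
    by (simp add: \<epsilon>.diff \<epsilon>.scale \<theta>u mult.commute)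
  from exact[OF _ this] obtain t13 where t13: "t13 \<in> free_vecs a" "vec_smult Z u1 - vec_smult X u3 = \<delta> t13"
    by (rule imageE) (auto intro: sub u)
  have "\<epsilon> (vec_smult Z u2 - vec_smult Y u3) = 0"
    by (simp add: \<epsilon>.diff \<epsilon>.scale \<theta>u mult.commute)
  from exact[OF _ this] obtain t23 where t23: "t23 \<in> free_vecs a" "vec_smult Z u2 - vec_smult Y u3 = \<delta> t23"
    by (rule imageE) (auto intro: sub u)
  have "\<delta> (vec_smult Z t12 - vec_smult Y t13 + vec_smult X t23) = 0"
    by (simp add: \<delta>.add \<delta>.diff \<delta>.scale flip: t12(2) t13(2) t23(2))
      (simp add: fun_eq_iff algebra_simps)
  then have "vec_smult Z t12 - vec_smult Y t13 + vec_smult X t23 = 0"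
    by (rule inj[rotated]) (intro sub(2) sub(1) sub(3) t12(1) t13(1) t23(1))
  then have "vec_smult Z t12 = vec_smult Y t13 - vec_smult X t23" by (simp add: algebra_simps)
  from regular_XYZ_vec[OF this t12(1)] obtain p q where pq: "p \<in> free_vecs a" "q \<in> free_vecs a"
    "t12 = vec_smult Y p - vec_smult X q" by blast
  have "vec_smult Y u1 - vec_smult X u2 = vec_smult Y (\<delta> p) - vec_smult X (\<delta> q)"
    by (simp add: t12(2) pq(3) \<delta>.diff \<delta>.scale)
  then have "vec_smult Y (u1 - \<delta> p) = vec_smult X (u2 - \<delta> q)"
    by (simp add: algebra_simps)
  moreover have "u1 - \<delta> p \<in> free_vecs b" using u cod pq by (simp add: sub)
  ultimately obtain u' where u': "u' \<in> free_vecs b" "u1 - \<delta> p = vec_smult X u'"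
    using regular_XY_vec by blast
  have "s X \<theta> = \<epsilon> (u1 - \<delta> p)" by (simp add: \<epsilon>.diff \<theta>u complex pq)
  then have "s X (\<theta> - \<epsilon> u') = 0" by (simp add: u'(2) \<epsilon>.scale \<epsilon>.m2.scale_right_diff_distrib)
  then have "\<theta> = \<epsilon> u'" using torsion_free by fastforce
  then show ?thesis using u' by blast
qed

lemma last_power_outside:
  assumes W: "Modules.module s" and "\<theta> \<notin> W" "s (g ^ n) \<theta> \<in> W"
  shows "\<exists>k. s (g ^ k) \<theta> \<notin> W \<and> s g (s (g ^ k) \<theta>) \<in> W"
proof -
  interpret Modules.module s by fact
  define l where "l = (LEAST l. s (g ^ l) \<theta> \<in> W)"
  have l: "s (g ^ l) \<theta> \<in> W" unfolding l_def using assms(3) by (rule LeastI)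
  then obtain k where k: "l = Suc k" using assms(2) by (cases l) auto
  then have "s (g ^ k) \<theta> \<notin> W" unfolding l_def by (metis lessI not_less_Least)
  then show ?thesis using l k by (intro exI[of _ k]) simp
qed

text \<open>
  The elements \<open>h\<close> with \<open>h \<theta> \<in> W\<close> form an ideal, which by the Nullstellensatz contains powers of the
  three variables. If \<open>\<theta>\<close> were not in \<open>W\<close>, multiplying it by the last power of each variable that stays
  outside \<open>W\<close> would produce an element outside \<open>W\<close> that all three variables move into \<open>W\<close>.
\<close>

theorem mem_of_locally_mem:
  assumes mod: "Modules.module s" and W: "module.subspace s W"
    and sat: "\<And>\<theta>. s X \<theta> \<in> W \<Longrightarrow> s Y \<theta> \<in> W \<Longrightarrow> s Z \<theta> \<in> W \<Longrightarrow> \<theta> \<in> W"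
    and loc: "\<And>p. p \<noteq> 0 \<Longrightarrow> \<exists>h. s h \<theta> \<in> W \<and> eval3 h p \<noteq> 0"
  shows "\<theta> \<in> W"
proof (rule ccontr)
  interpret Modules.module s by fact
  assume out: "\<theta> \<notin> W"
  define J where "J = {h. s h \<theta> \<in> W}"
  have "ideal J S_ring"
    unfolding ideal_S_ring_iff J_def
    using subspace_0[OF W] subspace_add[OF W] subspace_scale[OF W]
    by (auto simp: scale_left_distrib simp flip: scale_scale)
  then have "\<exists>n. g ^ n \<in> J" if "eval3 g 0 = 0" for g
  proof (rule Nullstellensatz)
    fix p assume "\<And>h. h \<in> J \<Longrightarrow> eval3 h p = 0"
    then have "p = 0" using loc[of p] by (auto simp only: J_def mem_Collect_eq)
    then show "eval3 g p = 0" using that by simp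
  qed
  from this[of X] this[of Y] this[of Z] obtain n1 n2 n3 where
    n: "s (X ^ n1) \<theta> \<in> W" "s (Y ^ n2) \<theta> \<in> W" "s (Z ^ n3) \<theta> \<in> W"
    by (auto simp: J_def zero_prod_def eval3_XYZ)
  have mult: "s h (s g \<eta>) \<in> W" if "s h \<eta> \<in> W" for g h \<eta>
    using subspace_scale[OF W that, of g] by (simp add: mult.commute)
  obtain k1 where k1: "s (X ^ k1) \<theta> \<notin> W" "s X (s (X ^ k1) \<theta>) \<in> W"
    using last_power_outside[OF mod out n(1)] by blast
  obtain k2 where k2: "s (Y ^ k2) (s (X ^ k1) \<theta>) \<notin> W" "s Y (s (Y ^ k2) (s (X ^ k1) \<theta>)) \<in> W"
    using last_power_outside[OF mod k1(1) mult[OF n(2)]] by blast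
  obtain k3 where k3: "s (Z ^ k3) (s (Y ^ k2) (s (X ^ k1) \<theta>)) \<notin> W"
    "s Z (s (Z ^ k3) (s (Y ^ k2) (s (X ^ k1) \<theta>))) \<in> W"
    using last_power_outside[OF mod k2(1) mult[OF mult[OF n(3)]]] by blast
  have "s (Z ^ k3) (s (Y ^ k2) (s (X ^ k1) \<theta>)) \<in> W"
    by (rule sat[OF mult[OF mult[OF k1(2)]] mult[OF k2(2)] k3(2)])
  then show False using k3 by blast
qed

section \<open>Logarithmic forms of a normal crossing divisor\<close>

text \<open>
  The coefficient of \<open>dx \<and> dy \<and> dz\<close> in the product of a 2-form and a 1-form. Identifying a 2-form with a
  vector field \<open>\<theta>\<close>, \<open>pairing \<theta> (ext_d g)\<close> is the derivative of \<open>g\<close> along \<open>\<theta>\<close>, and \<open>wedge\<close> is the cross product.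
\<close>

definition pairing :: "form2 \<Rightarrow> form1 \<Rightarrow> poly3" where
  "pairing = (\<lambda>(a, b, c) (p, q, r). a * p + b * q + c * r)"

lemmas form_defs = wedge_def form_smult_def pairing_def zero_prod_def

lemma wedge_self [simp]: "wedge \<alpha> \<alpha> = 0"
  and wedge_swap: "wedge \<beta> \<alpha> = - wedge \<alpha> \<beta>"
  and wedge_0_left [simp]: "wedge 0 \<beta> = 0"
  and wedge_0_right [simp]: "wedge \<alpha> 0 = 0"
  and wedge_add_left: "wedge (\<alpha> + \<alpha>') \<beta> = wedge \<alpha> \<beta> + wedge \<alpha>' \<beta>"
  and wedge_add_right: "wedge \<alpha> (\<beta> + \<beta>') = wedge \<alpha> \<beta> + wedge \<alpha> \<beta>'"
  and wedge_smult_left: "wedge (form_smult s \<alpha>) \<beta> = form_smult s (wedge \<alpha> \<beta>)"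
  and wedge_smult_right: "wedge \<alpha> (form_smult s \<beta>) = form_smult s (wedge \<alpha> \<beta>)"
  and pairing_wedge_left [simp]: "pairing (wedge \<alpha> \<beta>) \<alpha> = 0"
  and pairing_0_left [simp]: "pairing 0 \<alpha> = 0"
  and pairing_0_right [simp]: "pairing \<omega> 0 = 0"
  and pairing_add_left: "pairing (\<omega> + \<omega>') \<alpha> = pairing \<omega> \<alpha> + pairing \<omega>' \<alpha>"
  and pairing_add_right: "pairing \<omega> (\<alpha> + \<beta>) = pairing \<omega> \<alpha> + pairing \<omega> \<beta>"
  and pairing_smult_left: "pairing (form_smult s \<omega>) \<alpha> = s * pairing \<omega> \<alpha>"
  and pairing_smult_right: "pairing \<omega> (form_smult s \<alpha>) = s * pairing \<omega> \<alpha>"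
  by (cases \<alpha>; cases \<beta>; cases \<omega>; cases \<alpha>'; cases \<beta>'; cases \<omega>';
      simp add: form_defs algebra_simps)+

lemma wedge_sum_left: "wedge (\<Sum>i\<in>A. g i) \<beta> = (\<Sum>i\<in>A. wedge (g i) \<beta>)"
  by (induction A rule: infinite_finite_induct) (auto simp: wedge_add_left)

lemma wedge_sum_right: "wedge \<alpha> (\<Sum>i\<in>A. g i) = (\<Sum>i\<in>A. wedge \<alpha> (g i))"
  by (induction A rule: infinite_finite_induct) (auto simp: wedge_add_right)

lemma pairing_sum_left: "pairing (\<Sum>i\<in>A. g i) \<beta> = (\<Sum>i\<in>A. pairing (g i) \<beta>)"
  by (induction A rule: infinite_finite_induct) (auto simp: pairing_add_left)

lemma pairing_sum_right: "pairing \<omega> (\<Sum>i\<in>A. g i) = (\<Sum>i\<in>A. pairing \<omega> (g i))"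
  by (induction A rule: infinite_finite_induct) (auto simp: pairing_add_right)

lemma form_smult_cancel: "s \<noteq> 0 \<Longrightarrow> form_smult s \<alpha> = form_smult s \<beta> \<longleftrightarrow> \<alpha> = \<beta>"
  by (cases \<alpha>; cases \<beta>) (simp add: form_smult_def)

lemma form_smult_eq_0: "form_smult s \<alpha> = 0 \<longleftrightarrow> s = 0 \<or> \<alpha> = 0"
  by (cases \<alpha>) (auto simp: form_defs)

lemma Cramer:
  "form_smult (pairing (wedge \<alpha> \<beta>) \<gamma>) \<omega> = form_smult (pairing \<omega> \<alpha>) (wedge \<beta> \<gamma>)
     + form_smult (pairing \<omega> \<beta>) (wedge \<gamma> \<alpha>) + form_smult (pairing \<omega> \<gamma>) (wedge \<alpha> \<beta>)"
  by (cases \<alpha>; cases \<beta>; cases \<gamma>; cases \<omega>) (simp add: form_defs algebra_simps)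

text \<open>
  The expansion of the double cross product. With the Euler field as \<open>\<alpha>\<close> it computes, up to sign, the
  contraction of \<open>\<omega> \<and> \<gamma>\<close> with the Euler field; with \<open>dF\<close> as \<open>\<alpha>\<close> and \<open>\<omega> \<in> D_0(F)\<close> it shows that the partial
  derivatives of \<open>F\<close> multiply \<open>\<omega>\<close> to forms \<open>dF \<and> \<eta>\<close>.
\<close>

lemma double_wedge:
  "wedge \<alpha> (wedge \<omega> \<gamma>) = form_smult (pairing \<gamma> \<alpha>) \<omega> - form_smult (pairing \<omega> \<alpha>) \<gamma>"
  by (cases \<alpha>; cases \<gamma>; cases \<omega>) (simp add: form_defs algebra_simps)

lemma ext_d_XYZ: "ext_d X = (1, 0, 0)" "ext_d Y = (0, 1, 0)" "ext_d Z = (0, 0, 1)"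
  by (simp_all add: ext_d_def)

lemma sum_triple: "(\<Sum>i\<in>A. (a i, b i, c i)) = (\<Sum>i\<in>A. a i, \<Sum>i\<in>A. b i, \<Sum>i\<in>A. c i)"
  by (induction A rule: infinite_finite_induct) (auto simp: zero_prod_def)

lemma ext_d_prod:
  "finite A \<Longrightarrow> ext_d (\<Prod>i\<in>A. g i) = (\<Sum>i\<in>A. form_smult (\<Prod>k\<in>A - {i}. g k) (ext_d (g i)))"
  by (simp add: ext_d_def form_smult_def sum_triple dx.prod dy.prod dz.prod)

definition euler_vec :: "form2" where "euler_vec = (X, Y, Z)"

lemma pairing_euler: "g \<in> homog_part (int n) \<Longrightarrow> pairing euler_vec (ext_d g) = of_nat n * g"
  using Euler[of g n] by (simp add: euler_vec_def ext_d_def pairing_def)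

text \<open>
  The three equations say that the cross product of the two vectors vanishes.
\<close>

lemma proportional_same_kernel:
  fixes a b c :: "'a::field"
  assumes "(a, b, c) \<noteq> (0, 0, 0)" "(a', b', c') \<noteq> (0, 0, 0)"
    and "b * c' = c * b'" "a * c' = c * a'" "a * b' = b * a'"
  shows "a * u + b * v + c * w = 0 \<longleftrightarrow> a' * u + b' * v + c' * w = 0"
proof -
  have "a * (a' * u + b' * v + c' * w) - a' * (a * u + b * v + c * w)
      = (a * b' - b * a') * v + (a * c' - c * a') * w"
    "b * (a' * u + b' * v + c' * w) - b' * (a * u + b * v + c * w)
      = (b * c' - c * b') * w - (a * b' - b * a') * u"
    "c * (a' * u + b' * v + c' * w) - c' * (a * u + b * v + c * w)
      = - (a * c' - c * a') * u - (b * c' - c * b') * v"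
    by (simp_all add: algebra_simps)
  then have 1: "a * (a' * u + b' * v + c' * w) = a' * (a * u + b * v + c * w)"
    and 2: "b * (a' * u + b' * v + c' * w) = b' * (a * u + b * v + c * w)"
    and 3: "c * (a' * u + b' * v + c' * w) = c' * (a * u + b * v + c * w)"
    using assms(3-5) by auto
  show ?thesis using 1 2 3 assms(1,2) by auto
qed

lemma prime_elem_dvd_prod:
  fixes g :: "'i \<Rightarrow> 'a::comm_semiring_1"
  assumes "prime_elem p" "finite A" "p dvd (\<Prod>k\<in>A. g k)"
  shows "\<exists>k\<in>A. p dvd g k"
  using assms(2,3,1)
  by (induction A rule: finite_induct) (auto simp: prime_elem_dvd_mult_iff dest: prime_elem_not_unit)

lemma curve_mono: "g dvd h \<Longrightarrow> curve g \<subseteq> curve h"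
  by (auto simp: curve_def eval3_mult elim!: dvdE)

locale nc_curves =
  fixes m :: nat and f :: "nat \<Rightarrow> poly3" and e :: "nat \<Rightarrow> nat"
  assumes deg: "\<And>j. j \<in> {1..m} \<Longrightarrow> f j \<in> homog_part (int (e j))"
    and irred: "\<And>j. j \<in> {1..m} \<Longrightarrow> irreducible (f j)"
    and smooth: "\<And>j. j \<in> {1..m} \<Longrightarrow> smooth_curve (f j)"
    and distinct: "inj_on (\<lambda>j. curve (f j)) {1..m}"
    and nc: "normal_crossing {1..m} f"
    and m_pos: "m \<ge> 1"
begin

definition F :: poly3 where "F = (\<Prod>j\<in>{1..m}. f j)"

definition d :: nat where "d = (\<Sum>j\<in>{1..m}. e j)"

abbreviation cofactor :: "nat \<Rightarrow> poly3" where
  "cofactor j \<equiv> (\<Prod>k\<in>{1..m} - {j}. f k)"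

lemma f_nz: "j \<in> {1..m} \<Longrightarrow> f j \<noteq> 0"
  using irred irreducible_not_unit by (fastforce simp: irreducible_def)

lemma F_nz: "F \<noteq> 0"
  using f_nz by (simp add: F_def)

lemma F_cofactor: "j \<in> {1..m} \<Longrightarrow> F = f j * cofactor j"
  unfolding F_def by (rule prod.remove) auto

lemma e_pos: "j \<in> {1..m} \<Longrightarrow> e j \<ge> 1"
proof (rule ccontr)
  assume j: "j \<in> {1..m}" and "\<not> e j \<ge> 1"
  then have "e j = 0" by simp
  then have "is_unit (f j)" using deg[OF j] f_nz[OF j] homog_0_unit by simp
  then show False using irred[OF j] by (simp add: irreducible_def)
qed

lemma d_pos: "d \<ge> 1"
  using e_pos[of 1] member_le_sum[of 1 "{1..m}" e] m_pos unfolding d_def by simp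

lemma F_homog: "F \<in> homog_part (int d)"
  unfolding F_def d_def of_nat_sum using deg by (intro homog_prod)

lemma prime_f: "j \<in> {1..m} \<Longrightarrow> prime_elem (f j)"
  by (intro irreducible_imp_prime_elem irred)

lemma f_dvd_imp_eq:
  assumes ij: "i \<in> {1..m}" "j \<in> {1..m}" and dvd: "f i dvd f j"
  shows "i = j"
proof -
  have "f j dvd f i"
    using irreducibleD'[OF irred[OF ij(2)] dvd] irred[OF ij(1)] by (auto simp: irreducible_def)
  then have "curve (f i) = curve (f j)"
    using dvd by (intro antisym curve_mono)
  then show ?thesis using distinct ij by (auto dest: inj_onD)
qed

lemma f_not_dvd_cofactor: "j \<in> {1..m} \<Longrightarrow> \<not> f j dvd cofactor j"
proof
  assume j: "j \<in> {1..m}" and "f j dvd cofactor j"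
  then obtain k where "k \<in> {1..m} - {j}" "f j dvd f k"
    using prime_elem_dvd_prod[OF prime_f[OF j], of "{1..m} - {j}" f] by blast
  then show False using f_dvd_imp_eq[of j k] j by auto
qed

lemma ext_d_F: "ext_d F = (\<Sum>j\<in>{1..m}. form_smult (cofactor j) (ext_d (f j)))"
  unfolding F_def by (rule ext_d_prod) simp

text \<open>
  This is the definition \<open>\<omega>_j = dF \<and> df_j / f_j\<close>; in the expansion of \<open>dF\<close> all terms except the one with
  \<open>df_j\<close>, which does not contribute, are divisible by \<open>f_j\<close>.
\<close>

lemma f_omega:
  assumes j: "j \<in> {1..m}"
  shows "form_smult (f j) (omega m f j) = wedge (ext_d F) (ext_d (f j))"
proof -
  have "wedge (ext_d F) (ext_d (f j)) =
      (\<Sum>i\<in>{1..m}. form_smult (cofactor i) (wedge (ext_d (f i)) (ext_d (f j))))"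
    by (simp add: ext_d_F wedge_sum_left wedge_smult_left)
  also have "\<dots> = (\<Sum>i\<in>{1..m} - {j}. form_smult (cofactor i) (wedge (ext_d (f i)) (ext_d (f j))))"
    using j by (subst sum.remove[of _ j]) auto
  also have "\<dots> = (\<Sum>i\<in>{1..m} - {j}. form_smult (f j) (form_smult (\<Prod>k\<in>{1..m} - {i, j}. f k)
      (wedge (ext_d (f i)) (ext_d (f j)))))"
  proof (rule sum.cong[OF refl])
    fix i assume i: "i \<in> {1..m} - {j}"
    have "{1..m} - {i} - {j} = {1..m} - {i, j}" by auto
    then have "cofactor i = f j * (\<Prod>k\<in>{1..m} - {i, j}. f k)"
      using i j prod.remove[of "{1..m} - {i}" j f] by auto
    then show "form_smult (cofactor i) (wedge (ext_d (f i)) (ext_d (f j))) =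
        form_smult (f j) (form_smult (\<Prod>k\<in>{1..m} - {i, j}. f k) (wedge (ext_d (f i)) (ext_d (f j))))"
      by simp
  qed
  finally show ?thesis by (simp add: omega_def forms.scale_sum_right)
qed

lemma F_omega:
  assumes j: "j \<in> {1..m}"
  shows "form_smult F (omega m f j) = wedge (ext_d F) (form_smult (cofactor j) (ext_d (f j)))"
proof -
  have "form_smult F (omega m f j) = form_smult (cofactor j) (form_smult (f j) (omega m f j))"
    by (simp only: F_cofactor[OF j] forms.scale_scale mult.commute)
  then show ?thesis by (simp only: f_omega[OF j] wedge_smult_right)
qed

text \<open>
  \<open>F\<close> times the sum is \<open>dF \<and> dF\<close>.
\<close>

lemma sum_omega: "(\<Sum>j\<in>{1..m}. omega m f j) = 0"
proof -
  have "form_smult F (\<Sum>j\<in>{1..m}. omega m f j) =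
      wedge (ext_d F) (\<Sum>j\<in>{1..m}. form_smult (cofactor j) (ext_d (f j)))"
    unfolding forms.scale_sum_right wedge_sum_right by (intro sum.cong refl F_omega)
  also have "\<dots> = wedge (ext_d F) (ext_d F)" by (simp only: ext_d_F)
  finally show ?thesis using F_nz by (simp add: form_smult_eq_0)
qed

lemma pairing_omega_F: "j \<in> {1..m} \<Longrightarrow> pairing (omega m f j) (ext_d F) = 0"
  using f_nz[of j] pairing_smult_left[of "f j" "omega m f j" "ext_d F"] by (simp add: f_omega)

text \<open>
  A vector field that kills \<open>F\<close> is tangent to every component: modulo \<open>f_j\<close>, the derivative of
  \<open>F\<close> along \<open>\<theta>\<close> is the derivative of \<open>f_j\<close> times the product of the other components, which is prime to
  \<open>f_j\<close>.
\<close>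

lemma logarithmic:
  assumes \<theta>: "pairing \<theta> (ext_d F) = 0" and j: "j \<in> {1..m}"
  shows "f j dvd pairing \<theta> (ext_d (f j))"
proof -
  have "(\<Sum>i\<in>{1..m}. cofactor i * pairing \<theta> (ext_d (f i))) = 0"
    using \<theta> by (simp add: ext_d_F pairing_sum_right pairing_smult_right)
  then have "cofactor j * pairing \<theta> (ext_d (f j)) =
      - (\<Sum>i\<in>{1..m} - {j}. cofactor i * pairing \<theta> (ext_d (f i)))"
    using j by (simp add: sum.remove[of _ j] eq_neg_iff_add_eq_0)
  also have "f j dvd \<dots>"
  proof -
    have "f j dvd cofactor i" if "i \<in> {1..m} - {j}" for i
      using that j by (intro dvd_prodI) auto
    then show ?thesis by (intro dvd_minus_iff[THEN iffD2] dvd_sum dvd_mult2)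
  qed
  finally show ?thesis using prime_f[OF j] f_not_dvd_cofactor[OF j] by (simp add: prime_elem_dvd_mult_iff)
qed

text \<open>
  Cramer's rule for \<open>dF\<close>, \<open>df_j\<close>, \<open>\<gamma>\<close> expresses a multiple of \<open>\<theta>\<close> by \<open>dF \<and> df_j = f_j \<omega>_j\<close> and \<open>dF \<and> \<gamma>\<close>, the third term
  vanishing because \<open>\<theta>\<close> kills \<open>F\<close>. As \<open>\<theta>\<close> is tangent to the component, the factor \<open>f_j\<close> cancels throughout.
\<close>

lemma omega_annihilates:
  assumes \<theta>: "pairing \<theta> (ext_d F) = 0" and j: "j \<in> {1..m}"
  shows "\<exists>g. form_smult (pairing (omega m f j) \<gamma>) \<theta> =
    form_smult (pairing \<theta> \<gamma>) (omega m f j) - form_smult g (wedge (ext_d F) \<gamma>)"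
proof -
  obtain g where g: "pairing \<theta> (ext_d (f j)) = f j * g"
    using logarithmic[OF assms] by (rule dvdE)
  have w: "wedge (ext_d (f j)) (ext_d F) = - form_smult (f j) (omega m f j)"
    by (simp add: f_omega[OF j] wedge_swap[of "ext_d (f j)"])
  have "form_smult (pairing (wedge (ext_d F) (ext_d (f j))) \<gamma>) \<theta> =
      form_smult (pairing \<theta> \<gamma>) (wedge (ext_d F) (ext_d (f j)))
      - form_smult (pairing \<theta> (ext_d (f j))) (wedge (ext_d F) \<gamma>)"
    using Cramer[of "ext_d F" "ext_d (f j)" \<gamma> \<theta>] \<theta> by (simp add: wedge_swap[of \<gamma> "ext_d F"])
  then have "form_smult (f j) (form_smult (pairing (omega m f j) \<gamma>) \<theta>) =
      form_smult (f j) (form_smult (pairing \<theta> \<gamma>) (omega m f j) - form_smult g (wedge (ext_d F) \<gamma>))"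
    by (simp add: g pairing_smult_left forms.scale_right_diff_distrib mult.commute flip: f_omega[OF j])
  then show ?thesis using form_smult_cancel[OF f_nz[OF j]] by blast
qed

text \<open>
  By Euler's formula a zero of all partial derivatives of \<open>F\<close> is a zero of \<open>F\<close>, hence of some \<open>f_i\<close>. There
  \<open>dF\<close> is \<open>df_i\<close> times the product of the other components, and \<open>df_i\<close> does not vanish by smoothness.
\<close>

lemma singular_point_is_node:
  assumes p: "p \<noteq> 0"
    and zero: "eval3 (dx F) p = 0" "eval3 (dy F) p = 0" "eval3 (dz F) p = 0"
  shows "\<exists>i\<in>{1..m}. \<exists>j\<in>{1..m}. i \<noteq> j \<and> p \<in> curve (f i) \<inter> curve (f j)"
proof -
  have "eval3 (X * dx F + Y * dy F + Z * dz F) p = 0"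
    using zero by (simp add: eval3_add eval3_mult)
  then have "eval3 F p = 0" using d_pos by (simp add: Euler[OF F_homog] eval3_mult eval3_of_nat)
  then obtain i where i: "i \<in> {1..m}" "eval3 (f i) p = 0" by (auto simp: F_def eval3_prod)
  have grad: "eval3 (D F) p = eval3 (cofactor i) p * eval3 (D (f i)) p" if "derivation D" for D
  proof -
    have "eval3 (D F) p = (\<Sum>k\<in>{1..m}. eval3 (cofactor k) p * eval3 (D (f k)) p)"
      unfolding F_def by (simp add: derivation.prod[OF that] eval3_sum eval3_mult)
    also have "\<dots> = eval3 (cofactor i) p * eval3 (D (f i)) p
        + (\<Sum>k\<in>{1..m} - {i}. eval3 (cofactor k) p * eval3 (D (f k)) p)"
      using i by (intro sum.remove) auto
    also have "(\<Sum>k\<in>{1..m} - {i}. eval3 (cofactor k) p * eval3 (D (f k)) p) = 0"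
      using i by (intro sum.neutral) (auto simp: eval3_prod intro!: prod_zero)
    finally show ?thesis by simp
  qed
  have "p \<in> curve (f i)" using i p by (simp add: curve_def)
  then have "(eval3 (dx (f i)) p, eval3 (dy (f i)) p, eval3 (dz (f i)) p) \<noteq> (0, 0, 0)"
    using smooth[OF i(1)] by (auto simp: smooth_curve_def)
  then have "eval3 (cofactor i) p = 0"
    using zero grad[OF dx.derivation_axioms] grad[OF dy.derivation_axioms] grad[OF dz.derivation_axioms]
    by auto
  then obtain j where "j \<in> {1..m} - {i}" "eval3 (f j) p = 0"
    unfolding eval3_prod by (meson finite_Diff finite_atLeastAtMost prod_zero_iff)
  then have "j \<in> {1..m}" "i \<noteq> j" "p \<in> curve (f i) \<inter> curve (f j)"
    using i p by (auto simp: curve_def)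
  then show ?thesis using i(1) by blast
qed

text \<open>
  At a common point of \<open>C_i\<close> and \<open>C_j\<close> all terms of \<open>\<omega>_i\<close> contain the factor \<open>f_j\<close>, except for a multiple of
  \<open>df_j \<and> df_i\<close> whose factor is the product of the remaining components. That product does not vanish,
  as at most two curves meet in a point, and \<open>df_j \<and> df_i\<close> does not vanish by transversality.
\<close>

lemma omega_nonzero_at_node:
  assumes ij: "i \<in> {1..m}" "j \<in> {1..m}" "i \<noteq> j" and p: "p \<in> curve (f i) \<inter> curve (f j)"
  shows "\<exists>\<gamma>. eval3 (pairing (omega m f i) \<gamma>) p \<noteq> 0"
proof (rule ccontr)
  assume none: "\<nexists>\<gamma>. eval3 (pairing (omega m f i) \<gamma>) p \<noteq> 0"
  have others: "eval3 (f k) p \<noteq> 0" if k: "k \<in> {1..m} - {i, j}" for k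
  proof
    assume "eval3 (f k) p = 0"
    then have "{i, j, k} \<subseteq> {l \<in> {1..m}. p \<in> curve (f l)}"
      using k ij p by (auto simp: curve_def)
    then have "card {i, j, k} \<le> card {l \<in> {1..m}. p \<in> curve (f l)}"
      by (intro card_mono) auto
    also have "\<dots> \<le> 2" using nc unfolding normal_crossing_def by blast
    finally show False using ij k by auto
  qed
  have eval_omega: "eval3 (pairing (omega m f i) \<gamma>) p =
      eval3 (\<Prod>k\<in>{1..m} - {j, i}. f k) p * eval3 (pairing (wedge (ext_d (f j)) (ext_d (f i))) \<gamma>) p" for \<gamma>
  proof -
    have "eval3 (pairing (omega m f i) \<gamma>) p = (\<Sum>l\<in>{1..m} - {i}. eval3 (\<Prod>k\<in>{1..m} - {l, i}. f k) p *
        eval3 (pairing (wedge (ext_d (f l)) (ext_d (f i))) \<gamma>) p)"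
      by (simp add: omega_def pairing_sum_left pairing_smult_left eval3_sum eval3_mult)
    also have "\<dots> = eval3 (\<Prod>k\<in>{1..m} - {j, i}. f k) p *
        eval3 (pairing (wedge (ext_d (f j)) (ext_d (f i))) \<gamma>) p +
        (\<Sum>l\<in>{1..m} - {i} - {j}. eval3 (\<Prod>k\<in>{1..m} - {l, i}. f k) p *
        eval3 (pairing (wedge (ext_d (f l)) (ext_d (f i))) \<gamma>) p)"
      using ij by (intro sum.remove) auto
    also have "(\<Sum>l\<in>{1..m} - {i} - {j}. eval3 (\<Prod>k\<in>{1..m} - {l, i}. f k) p *
        eval3 (pairing (wedge (ext_d (f l)) (ext_d (f i))) \<gamma>) p) = 0"
      using ij p by (intro sum.neutral) (auto simp: eval3_prod curve_def intro!: prod_zero bexI[of _ j])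
    finally show ?thesis by simp
  qed
  have "eval3 (\<Prod>k\<in>{1..m} - {j, i}. f k) p \<noteq> 0"
    using others by (auto simp: eval3_prod)
  then have z: "eval3 (pairing (wedge (ext_d (f j)) (ext_d (f i))) \<gamma>) p = 0" for \<gamma>
    using none eval_omega[of \<gamma>] by (metis mult_eq_0_iff)
  have cross: "eval3 (dy (f j)) p * eval3 (dz (f i)) p = eval3 (dz (f j)) p * eval3 (dy (f i)) p"
    "eval3 (dx (f j)) p * eval3 (dz (f i)) p = eval3 (dz (f j)) p * eval3 (dx (f i)) p"
    "eval3 (dx (f j)) p * eval3 (dy (f i)) p = eval3 (dy (f j)) p * eval3 (dx (f i)) p"
    using z[of "(1, 0, 0)"] z[of "(0, 1, 0)"] z[of "(0, 0, 1)"]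
    by (simp_all add: ext_d_def form_defs eval3_diff eval3_mult eval3_uminus)
  have "tangent_line (f j) p = tangent_line (f i) p"
    unfolding tangent_line_def
    using proportional_same_kernel[OF _ _ cross] smooth ij p by (simp add: smooth_curve_def)
  then show False using nc ij p by (auto simp: normal_crossing_def)
qed

text \<open>
  For \<open>W\<close> containing all the forms \<open>\<omega>_j\<close> and \<open>dF \<and> \<gamma>\<close>, the partial derivatives of \<open>F\<close> and the coefficients
  of the \<open>\<omega>_j\<close> multiply \<open>D_0(F)\<close> into \<open>W\<close>, and at each point outside the origin one of them is nonzero.
\<close>

theorem locally_generated:
  assumes \<theta>: "pairing \<theta> (ext_d F) = 0" and p: "p \<noteq> 0" and W: "forms.subspace W"
    and omega: "\<And>j. j \<in> {1..m} \<Longrightarrow> omega m f j \<in> W" and koszul: "\<And>\<gamma>. wedge (ext_d F) \<gamma> \<in> W"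
  shows "\<exists>h. form_smult h \<theta> \<in> W \<and> eval3 h p \<noteq> 0"
proof (cases "eval3 (dx F) p = 0 \<and> eval3 (dy F) p = 0 \<and> eval3 (dz F) p = 0")
  case True
  then obtain i j where ij: "i \<in> {1..m}" "j \<in> {1..m}" "i \<noteq> j" "p \<in> curve (f i) \<inter> curve (f j)"
    using singular_point_is_node[OF p] by blast
  then obtain \<gamma> where \<gamma>: "eval3 (pairing (omega m f i) \<gamma>) p \<noteq> 0"
    using omega_nonzero_at_node by blast
  obtain g where "form_smult (pairing (omega m f i) \<gamma>) \<theta> =
      form_smult (pairing \<theta> \<gamma>) (omega m f i) - form_smult g (wedge (ext_d F) \<gamma>)"
    using omega_annihilates[OF \<theta> ij(1)] by blast
  also have "\<dots> \<in> W"
    using forms.subspace_diff[OF W] forms.subspace_scale[OF W] omega[OF ij(1)] koszul by simp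
  finally show ?thesis using \<gamma> by blast
next
  case False
  have "form_smult (pairing \<gamma> (ext_d F)) \<theta> \<in> W" for \<gamma>
    using koszul[of "wedge \<theta> \<gamma>"] \<theta> by (simp add: double_wedge)
  from this[of "(1, 0, 0)"] this[of "(0, 1, 0)"] this[of "(0, 0, 1)"] show ?thesis
    using False by (auto simp: pairing_def ext_d_def)
qed

end

section \<open>Generators and relations when one component is a line\<close>

lemma pairing_commute: "pairing \<alpha> \<beta> = pairing \<beta> \<alpha>"
  by (cases \<alpha>; cases \<beta>) (simp add: form_defs mult.commute)

lemma sum_apply: "(\<Sum>j\<in>A. g j) (i :: nat) = (\<Sum>j\<in>A. g j i :: poly3)"
  by (induction A rule: infinite_finite_induct) auto

lemma unit_vec_free: "k < n \<Longrightarrow> unit_vec k \<in> free_vecs n"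
  by (simp add: unit_vec_def free_vecs_def)

locale nc_curves_line = nc_curves +
  assumes f1: "f 1 = X" and m_ge: "m \<ge> 2"
begin

text \<open>
  The generators in the order that is fixed by \<open>rho\<close>: the index \<open>i\<close> stands for \<open>\<omega>_{i+1}\<close> if \<open>i < m - 1\<close>.
\<close>

definition gen :: "nat \<Rightarrow> form2" where
  "gen i = (if i < m - 1 then omega m f (Suc i) else if i = m - 1 then omega_y F else omega_z F)"

definition eps :: "(nat \<Rightarrow> poly3) \<Rightarrow> form2" where
  "eps v = (\<Sum>i<Suc m. form_smult (v i) (gen i))"

definition del :: "(nat \<Rightarrow> poly3) \<Rightarrow> nat \<Rightarrow> poly3" where
  "del u = (\<Sum>j\<in>{2..m}. vec_smult (u (j - 2)) (rho m f j))"

sublocale eps: module_hom vec_smult form_smult eps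
  by unfold_locales
    (simp_all add: eps_def forms.scale_left_distrib sum.distrib forms.scale_sum_right del: sum.lessThan_Suc)

sublocale del: module_hom vec_smult vec_smult del
  by unfold_locales
    (simp_all add: del_def vecs.scale_left_distrib sum.distrib vecs.scale_sum_right)

lemma f_line [simp]: "f (Suc 0) = X"
  using f1 by simp

lemma gen_last: "gen (m - 1) = omega_y F" "gen m = omega_z F"
  using m_ge by (auto simp: gen_def)

lemma eps_unit_vec: "k \<le> m \<Longrightarrow> eps (unit_vec k) = gen k"
proof -
  assume "k \<le> m"
  have "eps (unit_vec k) = (\<Sum>i<Suc m. if i = k then gen k else 0)"
    unfolding eps_def unit_vec_def by (intro sum.cong refl) auto
  then show ?thesis using \<open>k \<le> m\<close> by simp
qed

lemma del_unit_vec: "j \<in> {2..m} \<Longrightarrow> del (unit_vec (j - 2)) = rho m f j"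
proof -
  assume j: "j \<in> {2..m}"
  have "del (unit_vec (j - 2)) = (\<Sum>i\<in>{2..m}. if i = j then rho m f j else 0)"
    unfolding del_def unit_vec_def using j by (intro sum.cong refl) auto
  then show ?thesis using j by simp
qed

lemma sum_line: "(\<Sum>j\<in>{1..m}. h j) = h 1 + (\<Sum>j\<in>{2..m}. h j)" for h :: "nat \<Rightarrow> 'b::comm_monoid_add"
  using m_ge by (simp add: sum.atLeast_Suc_atMost numeral_2_eq_2)

lemma sum_last: "(\<Sum>j\<in>{1..m}. h j) = (\<Sum>j\<in>{1..m - 1}. h j) + h m" for h :: "nat \<Rightarrow> 'b::comm_monoid_add"
proof -
  have "{1..m} = insert m {1..m - 1}" using m_ge by auto
  moreover have "m \<notin> {1..m - 1}" using m_ge by auto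
  ultimately show ?thesis by (simp add: add.commute)
qed

lemma eps_gen_vec:
  assumes j: "j \<in> {1..m}"
  shows "eps (gen_vec m j) = omega m f j"
proof -
  have unit: "eps (unit_vec (k - 1)) = omega m f k" if "k \<in> {1..m - 1}" for k
    using that by (auto simp: eps_unit_vec gen_def)
  show ?thesis
  proof (cases "j = m")
    case True
    have "eps (gen_vec m j) = - (\<Sum>i\<in>{1..m - 1}. omega m f i)"
    proof -
      have "(\<Sum>k\<in>{1..m - 1}. eps (unit_vec (k - 1))) = (\<Sum>k\<in>{1..m - 1}. omega m f k)"
        by (intro sum.cong refl unit)
      then show ?thesis by (simp only: True gen_vec_def eps.neg eps.sum if_True refl)
    qed
    then show ?thesis
      using sum_omega True unfolding sum_last by (simp only: add_eq_0_iff)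
  next
    case False
    then have "j \<in> {1..m - 1}" using j by auto
    then show ?thesis using False by (simp only: gen_vec_def unit if_False)
  qed
qed

lemma omega_subst_eq: "j \<in> {1..m} \<Longrightarrow> omega_subst m f j = omega m f j"
  using sum_omega unfolding sum_last omega_subst_def by (auto simp: neg_eq_iff_add_eq_0 add.commute)

text \<open>
  Here the line \<open>f_1 = X\<close> is used: \<open>dF \<and> dx\<close> is \<open>X \<omega>_1\<close>, so it is not a new generator.
\<close>

lemma wedge_dF:
  "wedge (ext_d F) (a, b, c) = form_smult (X * a) (omega m f 1) + form_smult b (omega_y F) + form_smult c (omega_z F)"
proof -
  have "(a, b, c) = form_smult a (ext_d X) + form_smult b (ext_d Y) + form_smult c (ext_d Z)"
    by (simp add: ext_d_XYZ form_smult_def)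
  moreover have "wedge (ext_d F) (ext_d X) = form_smult X (omega m f 1)"
    using f_omega[of 1] f1 m_pos by simp
  ultimately show ?thesis
    by (simp add: wedge_add_right wedge_smult_right omega_y_def omega_z_def mult.commute)
qed

lemma omega_relation:
  "j \<in> {1..m} \<Longrightarrow> form_smult (f j) (omega m f j) =
     form_smult (X * dx (f j)) (omega m f 1) + form_smult (dy (f j)) (omega_y F) + form_smult (dz (f j)) (omega_z F)"
  by (simp only: f_omega ext_d_def[of "f j"] wedge_dF)

lemma eps_del: "eps (del u) = 0"
proof -
  have "eps (rho m f j) = 0" if "j \<in> {2..m}" for j
  proof -
    have "eps (unit_vec (m - 1)) = omega_y F" "eps (unit_vec m) = omega_z F"
      using eps_unit_vec[of "m - 1"] eps_unit_vec[of m] by (simp_all only: gen_last)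
    then show ?thesis
      using that m_ge omega_relation[of j]
      by (simp add: rho_def eps.diff eps.add eps.scale eps_gen_vec)
  qed
  then show ?thesis by (simp add: del_def eps.sum eps.scale)
qed

text \<open>
  In the free module the \<open>m\<close> vectors that represent \<open>\<omega>_1, \<dots>, \<omega>_m\<close> add up to zero, so a combination of
  them depends only on the differences of its coefficients.
\<close>

lemma sum_gen_vec:
  "(\<Sum>j\<in>{1..m}. vec_smult (a j) (gen_vec m j)) = (\<lambda>i. if i < m - 1 then a (Suc i) - a m else 0)"
proof
  fix i
  have g: "gen_vec m j i = (if j = Suc i then 1 else 0)" if "j \<in> {1..m - 1}" for j
    using that by (auto simp: gen_vec_def unit_vec_def)
  have "(\<Sum>k\<in>{1..m - 1}. unit_vec (k - 1) i) = (\<Sum>k\<in>{1..m - 1}. if k = Suc i then 1 else 0)"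
    by (intro sum.cong refl) (auto simp: unit_vec_def)
  then have gm: "gen_vec m m i = (if i < m - 1 then - 1 else 0)"
    by (auto simp: gen_vec_def sum_apply)
  have "(\<Sum>j\<in>{1..m}. vec_smult (a j) (gen_vec m j)) i =
      (\<Sum>j\<in>{1..m - 1}. a j * gen_vec m j i) + a m * gen_vec m m i"
    by (simp only: sum_apply vec_smult_apply sum_last plus_fun_apply)
  also have "(\<Sum>j\<in>{1..m - 1}. a j * gen_vec m j i) = (\<Sum>j\<in>{1..m - 1}. if j = Suc i then a j else 0)"
    using g by (intro sum.cong refl) auto
  also have "(\<Sum>j\<in>{1..m - 1}. if j = Suc i then a j else 0) + a m * gen_vec m m i =
      (if i < m - 1 then a (Suc i) - a m else 0)"
    by (auto simp: gm)
  finally show "(\<Sum>j\<in>{1..m}. vec_smult (a j) (gen_vec m j)) i = (if i < m - 1 then a (Suc i) - a m else 0)" .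
qed

text \<open>
  The combination of the \<open>\<rho>_j\<close> with coefficients \<open>u_j\<close>, for \<open>2 \<le> j \<le> m\<close>, has a symmetric description after a
  coefficient \<open>u_1\<close> is added that makes \<open>dx\<close> disappear from \<open>\<Sum> u_j df_j\<close> (recall \<open>df_1 = dx\<close>): it
  represents \<open>\<Sum> u_j f_j \<omega>_j - dF \<and> \<Sum> u_j df_j\<close>, both sums running over all \<open>j\<close>.
\<close>

definition all_coeffs :: "(nat \<Rightarrow> poly3) \<Rightarrow> nat \<Rightarrow> poly3" where
  "all_coeffs u j = (if j = 1 then - (\<Sum>k\<in>{2..m}. u (k - 2) * dx (f k)) else u (j - 2))"

lemma sum_all_coeffs:
  "(\<Sum>j\<in>{1..m}. all_coeffs u j * h j) = all_coeffs u 1 * h 1 + (\<Sum>j\<in>{2..m}. u (j - 2) * h j)"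
  unfolding sum_line by (simp add: all_coeffs_def)

lemma del_eq:
  "del u = (\<lambda>i. if i < m - 1 then all_coeffs u (Suc i) * f (Suc i) - all_coeffs u m * f m else 0)
     - vec_smult (\<Sum>j\<in>{1..m}. all_coeffs u j * dy (f j)) (unit_vec (m - 1))
     - vec_smult (\<Sum>j\<in>{1..m}. all_coeffs u j * dz (f j)) (unit_vec m)"
proof -
  have ext1: "all_coeffs u 1 * f 1 = - (\<Sum>j\<in>{2..m}. u (j - 2) * (X * dx (f j)))"
    by (simp add: all_coeffs_def sum_distrib_left sum_distrib_right ac_simps)
  have "del u = (\<Sum>j\<in>{2..m}. vec_smult (u (j - 2) * f j) (gen_vec m j))
     - vec_smult (\<Sum>j\<in>{2..m}. u (j - 2) * (X * dx (f j))) (gen_vec m 1)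
     - vec_smult (\<Sum>j\<in>{2..m}. u (j - 2) * dy (f j)) (unit_vec (m - 1))
     - vec_smult (\<Sum>j\<in>{2..m}. u (j - 2) * dz (f j)) (unit_vec m)"
    unfolding del_def rho_def
    by (simp add: vecs.scale_right_diff_distrib vecs.scale_right_distrib sum_subtractf sum.distrib
        vecs.scale_sum_left algebra_simps)
  also have "(\<Sum>j\<in>{2..m}. vec_smult (u (j - 2) * f j) (gen_vec m j)) =
      (\<Sum>j\<in>{2..m}. vec_smult (all_coeffs u j * f j) (gen_vec m j))"
    by (intro sum.cong refl) (simp add: all_coeffs_def)
  also have "(\<Sum>j\<in>{2..m}. vec_smult (all_coeffs u j * f j) (gen_vec m j))
     - vec_smult (\<Sum>j\<in>{2..m}. u (j - 2) * (X * dx (f j))) (gen_vec m 1) =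
     (\<Sum>j\<in>{1..m}. vec_smult (all_coeffs u j * f j) (gen_vec m j))"
    unfolding sum_line ext1 by (simp add: vecs.scale_minus_left)
  finally show ?thesis
    by (simp only: sum_gen_vec sum_all_coeffs f1 d_XYZ mult_zero_right add_0)
qed

lemma all_coeffs_dx: "(\<Sum>j\<in>{1..m}. all_coeffs u j * dx (f j)) = 0"
  unfolding sum_all_coeffs by (simp add: f1) (simp add: all_coeffs_def)

lemma del_free: "del u \<in> free_vecs (Suc m)"
  by (auto simp: del_eq free_vecs_def unit_vec_def)

text \<open>
  If the combination vanishes, then all \<open>u_j f_j\<close> are equal to one polynomial \<open>g\<close>, and \<open>\<Sum> u_j df_j = 0\<close>.
  Contraction with the Euler field turns the latter into \<open>d g = 0\<close>.
\<close>

lemma del_inj: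
  assumes u: "u \<in> free_vecs (m - 1)" and 0: "del u = 0"
  shows "u = 0"
proof -
  define g where "g = all_coeffs u m * f m"
  have m1: "m - 1 < m" "\<not> m \<le> m - 1" using m_ge by auto
  have eq: "all_coeffs u j * f j = g" if j: "j \<in> {1..m}" for j
  proof (cases "j = m")
    case False
    then obtain i where "j = Suc i" "i < m - 1" using j by (cases j) auto
    then have "del u i = all_coeffs u j * f j - g"
      by (simp add: del_eq unit_vec_def g_def)
    then show ?thesis using 0 by simp
  qed (simp add: g_def)
  have yz: "(\<Sum>j\<in>{1..m}. all_coeffs u j * dy (f j)) = 0" "(\<Sum>j\<in>{1..m}. all_coeffs u j * dz (f j)) = 0"
    using fun_cong[OF 0, of "m - 1"] fun_cong[OF 0, of m] m1 by (simp_all add: del_eq unit_vec_def)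
  have "of_nat d * g = (\<Sum>j\<in>{1..m}. all_coeffs u j * (of_nat (e j) * f j))"
    unfolding d_def of_nat_sum sum_distrib_right
    by (intro sum.cong refl) (simp flip: eq add: mult.left_commute)
  also have "\<dots> = (\<Sum>j\<in>{1..m}. X * (all_coeffs u j * dx (f j)) + Y * (all_coeffs u j * dy (f j)) + Z * (all_coeffs u j * dz (f j)))"
  proof (rule sum.cong[OF refl])
    fix j assume "j \<in> {1..m}"
    from Euler[OF deg[OF this]] have "of_nat (e j) * f j = X * dx (f j) + Y * dy (f j) + Z * dz (f j)" ..
    then show "all_coeffs u j * (of_nat (e j) * f j) = X * (all_coeffs u j * dx (f j))
        + Y * (all_coeffs u j * dy (f j)) + Z * (all_coeffs u j * dz (f j))"
      by (simp only: distrib_left mult.left_commute)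
  qed
  also have "\<dots> = 0"
    by (simp only: sum.distrib all_coeffs_dx yz mult_zero_right add_0 flip: sum_distrib_left)
  finally have "g = 0" using d_pos by simp
  then have "u (j - 2) = 0" if "j \<in> {2..m}" for j
    using eq[of j] f_nz[of j] that by (auto simp: all_coeffs_def)
  from this[of "i + 2" for i] have "u i = 0" if "i < m - 1" for i
    using that by auto
  moreover have "u i = 0" if "\<not> i < m - 1" for i
    using u that by (simp add: free_vecs_def)
  ultimately have "u i = 0" for i by blast
  then show ?thesis by (simp add: fun_eq_iff)
qed

text \<open>
  Modulo \<open>f_j\<close> only the \<open>j\<close>-th term is left, and \<open>f_j\<close> divides neither the cofactor nor all the
  partial derivatives of \<open>f_j\<close>.
\<close>

lemma coefficient_divisible:
  assumes rel: "(\<Sum>j\<in>{1..m}. form_smult (c j * cofactor j) (ext_d (f j))) = form_smult F \<beta>"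
    and j: "j \<in> {1..m}"
  shows "f j dvd c j"
proof (rule ccontr)
  assume no: "\<not> f j dvd c j"
  obtain b1 b2 b3 where \<beta>: "\<beta> = (b1, b2, b3)" by (cases \<beta>)
  have comp: "(\<Sum>k\<in>{1..m}. c k * cofactor k * dx (f k)) = F * b1"
    "(\<Sum>k\<in>{1..m}. c k * cofactor k * dy (f k)) = F * b2"
    "(\<Sum>k\<in>{1..m}. c k * cofactor k * dz (f k)) = F * b3"
    using rel by (simp_all add: \<beta> ext_d_def form_smult_def sum_triple)
  have dvd: "f j dvd h j" if "(\<Sum>k\<in>{1..m}. c k * cofactor k * h k) = F * b" for h b
  proof -
    have "c j * cofactor j * h j = F * b - (\<Sum>k\<in>{1..m} - {j}. c k * cofactor k * h k)"
      using j that by (simp add: sum.remove[of _ j] algebra_simps)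
    also have "f j dvd \<dots>"
    proof (intro dvd_diff dvd_sum)
      show "f j dvd F * b" using j by (simp add: F_cofactor)
      show "f j dvd c i * cofactor i * h i" if "i \<in> {1..m} - {j}" for i
      proof -
        have "f j dvd cofactor i" using that j by (intro dvd_prodI) auto
        then show ?thesis by (simp add: dvd_mult dvd_mult2)
      qed
    qed
    finally show ?thesis
      using prime_f[OF j] f_not_dvd_cofactor[OF j] no by (simp add: prime_elem_dvd_mult_iff)
  qed
  have "is_unit (f j) \<or> f j = 0"
    using dvd[OF comp(1)] dvd[OF comp(2)] dvd[OF comp(3)] by (rule not_dvd_partials)
  then show False using prime_f[OF j] by (auto dest: prime_elem_not_unit prime_elem_not_zeroI)
qed

theorem relations:
  assumes v: "v \<in> free_vecs (Suc m)" and ker: "eps v = 0"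
  shows "v \<in> del ` free_vecs (m - 1)"
proof -
  \<comment> \<open>Coefficients of all of \<open>\<omega>_1, \<dots>, \<omega>_m\<close>, with \<open>0\<close> for the superfluous \<open>\<omega>_m\<close>.\<close>
  define c where "c = (\<lambda>j. if j = m then 0 else v (j - 1))"
  define vy where "vy = v (m - 1)"
  define vz where "vz = v m"
  \<comment> \<open>\<open>F\<close> times the logarithmic form \<open>\<alpha>\<close> with \<open>dF \<and> \<alpha>\<close> equal to the image of \<open>v\<close>.\<close>
  define \<beta> where "\<beta> = (\<Sum>j\<in>{1..m}. form_smult (c j * cofactor j) (ext_d (f j))) + form_smult F (0, vy, vz)"
  have m1: "m - 1 < m" "\<not> m \<le> m - 1" using m_ge by auto
  have v_eq: "v = (\<Sum>j\<in>{1..m}. vec_smult (c j) (gen_vec m j))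
      + vec_smult vy (unit_vec (m - 1)) + vec_smult vz (unit_vec m)"
    unfolding sum_gen_vec using v m1 by (auto simp: fun_eq_iff c_def vy_def vz_def unit_vec_def free_vecs_def)
  have "eps v = (\<Sum>j\<in>{1..m}. form_smult (c j) (omega m f j)) + form_smult vy (omega_y F) + form_smult vz (omega_z F)"
    using m1 gen_last by (subst v_eq) (simp add: eps.add eps.sum eps.scale eps_gen_vec eps_unit_vec)
  then have "form_smult F 0 = form_smult F ((\<Sum>j\<in>{1..m}. form_smult (c j) (omega m f j))
      + form_smult vy (omega_y F) + form_smult vz (omega_z F))"
    by (simp only: ker)
  also have "\<dots> = (\<Sum>j\<in>{1..m}. form_smult (c j) (form_smult F (omega m f j)))
      + form_smult F (form_smult vy (omega_y F) + form_smult vz (omega_z F))"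
    by (simp add: forms.scale_right_distrib forms.scale_sum_right mult.commute)
  also have "\<dots> = wedge (ext_d F) \<beta>"
    by (simp add: F_omega \<beta>_def wedge_add_right wedge_sum_right wedge_smult_right wedge_dF)
  finally have "wedge (ext_d F) \<beta> = 0" by simp
  then have contr: "form_smult (pairing \<beta> euler_vec) (ext_d F) = form_smult (pairing (ext_d F) euler_vec) \<beta>"
    using double_wedge[of euler_vec "ext_d F" \<beta>] by simp
  \<comment> \<open>The contraction of \<open>\<alpha>\<close> with the Euler field.\<close>
  define \<mu> where "\<mu> = (\<Sum>j\<in>{1..m}. of_nat (e j) * c j) + (Y * vy + Z * vz)"
  have "pairing euler_vec \<beta> = F * \<mu>"
  proof -
    have "pairing euler_vec (form_smult (c j * cofactor j) (ext_d (f j))) = F * (of_nat (e j) * c j)"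
      if "j \<in> {1..m}" for j
      using that by (simp add: pairing_smult_right pairing_euler[OF deg] F_cofactor ac_simps)
    then have "(\<Sum>j\<in>{1..m}. pairing euler_vec (form_smult (c j * cofactor j) (ext_d (f j)))) =
        F * (\<Sum>j\<in>{1..m}. of_nat (e j) * c j)"
      unfolding sum_distrib_left by (intro sum.cong refl)
    moreover have "pairing euler_vec (0, vy, vz) = Y * vy + Z * vz"
      by (simp add: euler_vec_def pairing_def)
    ultimately show ?thesis
      unfolding \<beta>_def \<mu>_def
      by (simp only: pairing_add_right pairing_sum_right pairing_smult_right[of _ F] distrib_left)
  qed
  then have "form_smult F (form_smult \<mu> (ext_d F)) = form_smult F (form_smult (of_nat d) \<beta>)"
    using contr by (simp add: pairing_commute[of "ext_d F"] pairing_commute[of \<beta>] pairing_euler[OF F_homog] mult.commute)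
  \<comment> \<open>Contracting \<open>dF \<and> \<alpha> = 0\<close> shows that \<open>\<alpha>\<close> is the multiple \<open>\<mu>/d\<close> of \<open>dF/F = \<Sum> df_j/f_j\<close>.\<close>
  then have \<beta>: "form_smult \<mu> (ext_d F) = form_smult (of_nat d) \<beta>"
    using form_smult_cancel[OF F_nz] by blast
  define \<nu> where "\<nu> = const3 (1 / of_nat d) * \<mu>"
  have "of_nat d * \<nu> = (const3 (1 / of_nat d) * of_nat d) * \<mu>"
    by (simp only: \<nu>_def ac_simps)
  then have "of_nat d * \<nu> = \<mu>" by (simp only: const3_inverse_of_nat[OF d_pos] mult_1_left)
  then have d\<nu>: "form_smult (of_nat d) (form_smult \<nu> (ext_d F)) = form_smult (of_nat d) \<beta>"
    using \<beta> by simp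
  have "of_nat d \<noteq> (0 :: poly3)" using d_pos by simp
  from iffD1[OF form_smult_cancel[OF this] d\<nu>] have \<beta>: "\<beta> = form_smult \<nu> (ext_d F)" ..
  have "(\<Sum>j\<in>{1..m}. form_smult ((c j - \<nu>) * cofactor j) (ext_d (f j)))
      = (\<Sum>j\<in>{1..m}. form_smult (c j * cofactor j) (ext_d (f j))) - form_smult \<nu> (ext_d F)"
    by (subst ext_d_F)
      (simp add: left_diff_distrib forms.scale_left_diff_distrib sum_subtractf forms.scale_sum_right)
  also have "\<dots> = form_smult F (- (0, vy, vz))"
    by (simp only: \<beta>[symmetric] forms.scale_minus_right) (simp add: \<beta>_def)
  finally have rel: "(\<Sum>j\<in>{1..m}. form_smult ((c j - \<nu>) * cofactor j) (ext_d (f j))) = form_smult F (- (0, vy, vz))" .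
  have "\<forall>j. \<exists>q. j \<in> {1..m} \<longrightarrow> c j - \<nu> = f j * q"
    using coefficient_divisible[OF rel] by (auto simp: dvd_def)
  then obtain q where "\<forall>j. j \<in> {1..m} \<longrightarrow> c j - \<nu> = f j * q j"
    by (rule choice[THEN exE])
  then have q: "c j - \<nu> = f j * q j" if "j \<in> {1..m}" for j using that by blast
  have "form_smult F (\<Sum>j\<in>{1..m}. form_smult (q j) (ext_d (f j))) =
      (\<Sum>j\<in>{1..m}. form_smult ((c j - \<nu>) * cofactor j) (ext_d (f j)))"
    unfolding forms.scale_sum_right
    by (intro sum.cong refl) (simp add: q F_cofactor ac_simps)
  from iffD1[OF form_smult_cancel[OF F_nz] trans[OF this rel]]
  have "(\<Sum>j\<in>{1..m}. form_smult (q j) (ext_d (f j))) = - (0, vy, vz)" .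
  then have qx: "(\<Sum>j\<in>{1..m}. q j * dx (f j)) = 0" and qy: "(\<Sum>j\<in>{1..m}. q j * dy (f j)) = - vy"
    and qz: "(\<Sum>j\<in>{1..m}. q j * dz (f j)) = - vz"
    by (simp_all add: form_smult_def ext_d_def sum_triple)
  \<comment> \<open>The coefficient \<open>q 1\<close> is recovered by \<open>all_coeffs\<close> from the vanishing \<open>dx\<close>-component.\<close>
  define u where "u = (\<lambda>i. if i < m - 1 then q (i + 2) else 0)"
  have uq: "u (j - 2) = q j" if "j \<in> {2..m}" for j
  proof -
    have "j - 2 < m - 1" "j - 2 + 2 = j" using that by auto
    then show ?thesis by (simp only: u_def if_True)
  qed
  have "all_coeffs u 1 = q 1"
    using qx unfolding sum_line all_coeffs_def by (simp add: uq neg_eq_iff_add_eq_0 add.commute)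
  then have ext: "all_coeffs u j = q j" if "j \<in> {1..m}" for j
    using that uq[of j] by (cases "j = 1") (auto simp: all_coeffs_def)
  have "del u = (\<lambda>i. if i < m - 1 then c (Suc i) - c m else 0) + vec_smult vy (unit_vec (m - 1)) + vec_smult vz (unit_vec m)"
  proof -
    have "all_coeffs u (Suc i) * f (Suc i) - all_coeffs u m * f m = c (Suc i) - c m" if "i < m - 1" for i
      using that m_ge by (simp add: ext mult.commute flip: q)
    moreover have h: "(\<Sum>j\<in>{1..m}. all_coeffs u j * h j) = (\<Sum>j\<in>{1..m}. q j * h j)" for h
      by (intro sum.cong refl) (simp add: ext)
    ultimately show ?thesis
      unfolding del_eq h qy qz by (auto simp: fun_eq_iff)
  qed
  then have "v = del u" by (subst v_eq) (simp only: sum_gen_vec)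
  moreover have "u \<in> free_vecs (m - 1)" by (simp add: u_def free_vecs_def)
  ultimately show ?thesis by blast
qed

lemma eps_image_subspace: "forms.subspace (eps ` free_vecs (Suc m))"
  by (rule eps.subspace_image[OF free_vecs_subspace])

lemma omega_in_image: "j \<in> {1..m} \<Longrightarrow> omega m f j \<in> eps ` free_vecs (Suc m)"
proof (rule image_eqI)
  assume j: "j \<in> {1..m}"
  show "omega m f j = eps (gen_vec m j)" by (simp add: eps_gen_vec[OF j])
  show "gen_vec m j \<in> free_vecs (Suc m)"
    using j by (auto simp: gen_vec_def free_vecs_def unit_vec_def sum_apply intro!: sum.neutral)
qed

lemma koszul_in_image: "wedge (ext_d F) \<gamma> \<in> eps ` free_vecs (Suc m)"
proof -
  have "omega_y F = eps (unit_vec (m - 1))" "omega_z F = eps (unit_vec m)"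
    using eps_unit_vec[of "m - 1"] eps_unit_vec[of m] by (simp_all only: gen_last)
  moreover have "unit_vec (m - 1) \<in> free_vecs (Suc m)" "unit_vec m \<in> free_vecs (Suc m)"
    by (auto intro!: unit_vec_free)
  ultimately have "omega_y F \<in> eps ` free_vecs (Suc m)" "omega_z F \<in> eps ` free_vecs (Suc m)" by blast+
  moreover have "omega m f 1 \<in> eps ` free_vecs (Suc m)" using m_pos by (intro omega_in_image) auto
  ultimately show ?thesis
    using forms.subspace_add[OF eps_image_subspace] forms.subspace_scale[OF eps_image_subspace]
    by (cases \<gamma>) (simp add: wedge_dF)
qed

theorem generators: "eps ` free_vecs (Suc m) = {\<theta>. pairing \<theta> (ext_d F) = 0}"
proof (intro equalityI subsetI CollectI)
  fix \<theta> assume "\<theta> \<in> eps ` free_vecs (Suc m)"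
  moreover have "pairing (gen i) (ext_d F) = 0" if "i < Suc m" for i
    using that pairing_omega_F[of "Suc i"]
    by (auto simp: gen_def omega_y_def omega_z_def)
  ultimately show "pairing \<theta> (ext_d F) = 0"
    by (auto simp: eps_def pairing_add_left pairing_sum_left pairing_smult_left simp del: sum.lessThan_Suc)
next
  fix \<theta> assume "\<theta> \<in> {\<theta>. pairing \<theta> (ext_d F) = 0}"
  then have \<theta>: "pairing \<theta> (ext_d F) = 0" by simp
  show "\<theta> \<in> eps ` free_vecs (Suc m)"
  proof (rule mem_of_locally_mem)
    show "Modules.module form_smult" by (rule forms.module_axioms)
    show "forms.subspace (eps ` free_vecs (Suc m))" by (rule eps_image_subspace)
    fix \<eta> assume \<eta>: "form_smult X \<eta> \<in> eps ` free_vecs (Suc m)"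
      "form_smult Y \<eta> \<in> eps ` free_vecs (Suc m)" "form_smult Z \<eta> \<in> eps ` free_vecs (Suc m)"
    show "\<eta> \<in> eps ` free_vecs (Suc m)"
    proof (rule saturated_of_resolution[OF del.module_hom_axioms eps.module_hom_axioms])
      show "del u \<in> free_vecs (Suc m)" if "u \<in> free_vecs (m - 1)" for u by (rule del_free)
      show "u = 0" if "u \<in> free_vecs (m - 1)" "del u = 0" for u using that by (rule del_inj)
      show "eps (del u) = 0" if "u \<in> free_vecs (m - 1)" for u by (rule eps_del)
      show "v \<in> del ` free_vecs (m - 1)" if "v \<in> free_vecs (Suc m)" "eps v = 0" for v
        using that by (rule relations)
      show "\<theta>' = 0" if "form_smult X \<theta>' = 0" for \<theta>' using that by (simp add: form_smult_eq_0)
    qed (rule \<eta>)+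
  next
    fix p :: "complex \<times> complex \<times> complex" assume "p \<noteq> 0"
    then show "\<exists>h. form_smult h \<theta> \<in> eps ` free_vecs (Suc m) \<and> eval3 h p \<noteq> 0"
      by (rule locally_generated[OF \<theta> _ eps_image_subspace omega_in_image koszul_in_image])
  qed
qed

end

section \<open>Gradings and minimality\<close>

definition form_part :: "int \<Rightarrow> form2 set" where
  "form_part n = homog_part n \<times> homog_part n \<times> homog_part n"

lemma form_part_0 [simp]: "0 \<in> form_part n"
  by (simp add: form_part_def zero_prod_def)

lemma form_part_add: "\<alpha> \<in> form_part n \<Longrightarrow> \<beta> \<in> form_part n \<Longrightarrow> \<alpha> + \<beta> \<in> form_part n"
  by (auto simp: form_part_def homog_add)

lemma form_part_sum: "(\<And>i. i \<in> A \<Longrightarrow> g i \<in> form_part n) \<Longrightarrow> (\<Sum>i\<in>A. g i) \<in> form_part n"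
  by (induction A rule: infinite_finite_induct) (auto simp: form_part_add)

lemma form_part_smult:
  "s \<in> homog_part a \<Longrightarrow> \<alpha> \<in> form_part b \<Longrightarrow> a + b = n \<Longrightarrow> form_smult s \<alpha> \<in> form_part n"
  by (auto simp: form_part_def form_smult_def intro: homog_mult)

lemma form_part_wedge:
  assumes "\<alpha> \<in> form_part a" "\<beta> \<in> form_part b" "a + b = n"
  shows "wedge \<alpha> \<beta> \<in> form_part n"
  using assms(1,2) unfolding assms(3)[symmetric]
  by (auto simp: form_part_def wedge_def intro!: homog_diff homog_mult)

lemma form_part_ext_d: "g \<in> homog_part n \<Longrightarrow> ext_d g \<in> form_part (n - 1)"
  by (simp add: form_part_def ext_d_def homog_dx homog_dy homog_dz)

lemma ideal_irrelevant: "ideal irrelevant_ideal S_ring"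
proof -
  interpret cring S_ring by (rule cring_S_ring)
  show ?thesis unfolding irrelevant_ideal_def by (rule genideal_ideal) simp
qed

lemma XYZ_irrelevant: "X \<in> irrelevant_ideal" "Y \<in> irrelevant_ideal" "Z \<in> irrelevant_ideal"
proof -
  interpret cring S_ring by (rule cring_S_ring)
  have "{X, Y, Z} \<subseteq> irrelevant_ideal"
    unfolding irrelevant_ideal_def by (rule genideal_self) simp
  then show "X \<in> irrelevant_ideal" "Y \<in> irrelevant_ideal" "Z \<in> irrelevant_ideal" by auto
qed

text \<open>
  Euler's formula writes \<open>g\<close>, up to the invertible factor \<open>n\<close>, as a combination of the variables.
\<close>

lemma homog_irrelevant:
  assumes g: "g \<in> homog_part (int n)" and n: "n \<ge> 1"
  shows "g \<in> irrelevant_ideal"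
proof -
  have "dx g * X + dy g * Y + dz g * Z \<in> irrelevant_ideal"
    using XYZ_irrelevant by (intro ideal_add[OF ideal_irrelevant] ideal_mult[OF ideal_irrelevant])
  then have "of_nat n * g \<in> irrelevant_ideal"
    using Euler[OF g] by (simp only: mult.commute)
  then have "const3 (1 / of_nat n) * (of_nat n * g) \<in> irrelevant_ideal"
    by (rule ideal_mult[OF ideal_irrelevant])
  then show ?thesis using const3_inverse_of_nat[OF n] by (simp only: mult.assoc[symmetric] mult_1_left)
qed

lemma free_module_simps [simp]:
  "carrier (free_module as) = free_vecs (length as)"
  "v \<oplus>\<^bsub>free_module as\<^esub> w = v + w"
  "\<zero>\<^bsub>free_module as\<^esub> = 0"
  "s \<odot>\<^bsub>free_module as\<^esub> v = vec_smult s v"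
  "graded_part (free_module as) n = {v \<in> free_vecs (length as). \<forall>i<length as. v i \<in> homog_part (as ! i + n)}"
  by (auto simp: free_module_def free_vecs_def vec_smult_def)

lemma free_vecs_zero [simp]: "free_vecs 0 = {0}"
  by (auto simp: free_vecs_def fun_eq_iff)

lemma zero_free [simp]: "0 \<in> free_vecs n"
  by (simp add: free_vecs_def)

lemma graded_hom_free_vecs:
  assumes "module_hom vec_smult vec_smult \<phi>"
    and "\<And>v. v \<in> free_vecs (length as) \<Longrightarrow> \<phi> v \<in> free_vecs (length bs)"
    and "\<And>v n i. v \<in> graded_part (free_module as) n \<Longrightarrow> i < length bs \<Longrightarrow> \<phi> v i \<in> homog_part (bs ! i + n)"
  shows "graded_hom (free_module as) (free_module bs) \<phi>"
proof -
  interpret module_hom vec_smult vec_smult \<phi> by fact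
  show ?thesis
    using assms(2,3) by (auto simp: graded_hom_def add scale)
qed

lemma graded_hom_zero: "graded_hom (free_module []) (free_module bs) (\<lambda>_. 0)"
  by (rule graded_hom_free_vecs) (auto simp: module_hom_iff vecs.module_axioms)

lemma D0_simps [simp]:
  "carrier (D0 g) = {\<theta>. pairing \<theta> (ext_d g) = 0}"
  "v \<oplus>\<^bsub>D0 g\<^esub> w = v + w"
  "\<zero>\<^bsub>D0 g\<^esub> = 0"
  "s \<odot>\<^bsub>D0 g\<^esub> v = form_smult s v"
  "graded_part (D0 g) n = {\<theta> \<in> form_part n. pairing \<theta> (ext_d g) = 0}"
  by (auto simp: D0_def pairing_def ext_d_def form_part_def)

text \<open>
  The free module \<open>S^3\<close> in the resolution of the Jacobian algebra consists of functions on the natural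
  numbers, not of triples.
\<close>

definition form_vec :: "form2 \<Rightarrow> nat \<Rightarrow> poly3" where
  "form_vec = (\<lambda>(a, b, c) i. if i = 0 then a else if i = 1 then b else if i = 2 then c else 0)"

lemma form_vec_inj: "form_vec \<alpha> = form_vec \<beta> \<longleftrightarrow> \<alpha> = \<beta>"
proof
  assume eq: "form_vec \<alpha> = form_vec \<beta>"
  show "\<alpha> = \<beta>"
    using fun_cong[OF eq, of 0] fun_cong[OF eq, of 1] fun_cong[OF eq, of 2]
    by (cases \<alpha>; cases \<beta>) (simp add: form_vec_def)
qed simp

interpretation form_vec: module_hom form_smult vec_smult form_vec
  by unfold_locales (auto simp: form_vec_def form_smult_def fun_eq_iff split: prod.split)

text \<open>
  The twists of the two free modules in the resolution of \<open>D_0(F)\<close>. They occur twice, with different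
  shifts, and in both cases \<open>s = t + 1\<close>.
\<close>

definition twists0 :: "nat \<Rightarrow> int \<Rightarrow> int \<Rightarrow> int list" where
  "twists0 m s t = replicate (m - 1) s @ replicate 2 t"

definition twists1 :: "nat \<Rightarrow> (nat \<Rightarrow> nat) \<Rightarrow> int \<Rightarrow> int list" where
  "twists1 m e s = map (\<lambda>j. s - int (e j)) [2..<Suc m]"

locale nc_curves_one_line = nc_curves_line +
  assumes e_ge: "j \<in> {2..m} \<Longrightarrow> e j \<ge> 2"
begin

lemma e1: "e 1 = 1"
  using homog_degree_unique[of X "int (e 1)" 1] deg[of 1] homog_X m_pos by (simp add: f1)

lemma d_ge: "d \<ge> 3"
proof -
  have "d = e 1 + (\<Sum>j\<in>{2..m}. e j)" unfolding d_def by (rule sum_line)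
  moreover have "e 2 \<le> (\<Sum>j\<in>{2..m}. e j)" using m_ge by (intro member_le_sum) auto
  ultimately show ?thesis using e1 e_ge[of 2] m_ge by simp
qed

lemma length_twists [simp]: "length (twists0 m s t) = Suc m" "length (twists1 m e s) = m - 1"
  using m_ge by (simp_all add: twists0_def twists1_def)

lemma nth_twists0: "i < Suc m \<Longrightarrow> twists0 m s t ! i = (if i < m - 1 then s else t)"
  using m_ge by (auto simp: twists0_def nth_append nth_Cons')

lemma nth_twists1: "i < m - 1 \<Longrightarrow> twists1 m e s ! i = s - int (e (i + 2))"
  by (simp add: twists1_def nth_append add.commute del: upt_Suc)

lemma omega_homog:
  assumes j: "j \<in> {1..m}"
  shows "omega m f j \<in> form_part (int d - 2)"
  unfolding omega_def
proof (rule form_part_sum)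
  fix i assume i: "i \<in> {1..m} - {j}"
  have "(\<Prod>k\<in>{1..m} - {i, j}. f k) \<in> homog_part (\<Sum>k\<in>{1..m} - {i, j}. int (e k))"
    using deg by (intro homog_prod) auto
  moreover have "wedge (ext_d (f i)) (ext_d (f j)) \<in> form_part (int (e i) + int (e j) - 2)"
    using i j by (intro form_part_wedge[OF form_part_ext_d[OF deg] form_part_ext_d[OF deg]]) auto
  moreover have "(\<Sum>k\<in>{1..m} - {i, j}. int (e k)) + (int (e i) + int (e j) - 2) = int d - 2"
  proof -
    have "d = (\<Sum>k\<in>{1..m} - {i, j}. e k) + (\<Sum>k\<in>{i, j}. e k)"
      unfolding d_def using i j by (intro sum.subset_diff) auto
    then show ?thesis using i by simp
  qed
  ultimately show "form_smult (\<Prod>k\<in>{1..m} - {i, j}. f k) (wedge (ext_d (f i)) (ext_d (f j)))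
      \<in> form_part (int d - 2)"
    by (rule form_part_smult)
qed

lemma omega_yz_homog: "omega_y F \<in> form_part (int d - 1)" "omega_z F \<in> form_part (int d - 1)"
proof -
  have "ext_d Y \<in> form_part 0" "ext_d Z \<in> form_part 0"
    by (auto simp: ext_d_XYZ form_part_def homog_1)
  then show "omega_y F \<in> form_part (int d - 1)" "omega_z F \<in> form_part (int d - 1)"
    unfolding omega_y_def omega_z_def
    by (intro form_part_wedge[OF form_part_ext_d[OF F_homog]]; simp)+
qed

lemma gen_homog: "i < Suc m \<Longrightarrow> gen i \<in> form_part (if i < m - 1 then int d - 2 else int d - 1)"
  using omega_homog[of "Suc i"] omega_yz_homog by (auto simp: gen_def)

lemma eps_graded:
  assumes v: "v \<in> graded_part (free_module (twists0 m s t)) n" and st: "s = t + 1"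
  shows "eps v \<in> form_part (t + int d - 1 + n)"
  unfolding eps_def
proof (rule form_part_sum)
  fix i assume "i \<in> {..<Suc m}"
  then have "v i \<in> homog_part ((if i < m - 1 then s else t) + n)"
    and "gen i \<in> form_part (if i < m - 1 then int d - 2 else int d - 1)"
    using v gen_homog[of i] by (auto simp: nth_twists0 simp del: free_module_simps(1))
  then show "form_smult (v i) (gen i) \<in> form_part (t + int d - 1 + n)"
    by (rule form_part_smult) (simp add: st)
qed

lemma all_coeffs_homog:
  assumes u: "u \<in> graded_part (free_module (twists1 m e s)) n" and j: "j \<in> {1..m}"
  shows "all_coeffs u j \<in> homog_part (s - int (e j) + n)"
proof -
  have u': "u (k - 2) \<in> homog_part (s - int (e k) + n)" if "k \<in> {2..m}" for k
  proof -
    have "k - 2 < m - 1" "k - 2 + 2 = k" using that by auto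
    then show ?thesis using u nth_twists1[of "k - 2" s] by auto
  qed
  show ?thesis
  proof (cases "j = 1")
    case True
    have "u (k - 2) * dx (f k) \<in> homog_part (s - int (e j) + n)" if "k \<in> {2..m}" for k
      using homog_mult[OF u'[OF that] homog_dx[OF deg[of k]]] that True e1 by (simp add: algebra_simps)
    then show ?thesis using True by (auto simp: all_coeffs_def intro!: homog_uminus homog_sum)
  next
    case False
    then show ?thesis using j u'[of j] by (auto simp: all_coeffs_def)
  qed
qed

lemma del_graded:
  assumes u: "u \<in> graded_part (free_module (twists1 m e s)) n" and st: "s = t + 1" and i: "i < Suc m"
  shows "del u i \<in> homog_part (twists0 m s t ! i + n)"
proof -
  have lo: "all_coeffs u j * f j \<in> homog_part (s + n)" if "j \<in> {1..m}" for j
    using homog_mult[OF all_coeffs_homog[OF u that] deg[OF that]] by simp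
  have y: "all_coeffs u j * dy (f j) \<in> homog_part (t + n)"
    and z: "all_coeffs u j * dz (f j) \<in> homog_part (t + n)" if "j \<in> {1..m}" for j
    using homog_mult[OF all_coeffs_homog[OF u that] homog_dy[OF deg[OF that]]]
      homog_mult[OF all_coeffs_homog[OF u that] homog_dz[OF deg[OF that]]] by (simp_all add: st)
  consider "i < m - 1" | "i = m - 1" "i \<noteq> m" | "i = m" "i \<noteq> m - 1" using i m_ge by linarith
  then show ?thesis
  proof cases
    case 1
    then have "del u i = all_coeffs u (Suc i) * f (Suc i) - all_coeffs u m * f m"
      by (simp add: del_eq unit_vec_def)
    also have "\<dots> \<in> homog_part (s + n)" using 1 by (intro homog_diff lo) auto
    finally show ?thesis using 1 i by (simp add: nth_twists0)
  next
    case 2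
    then have "del u i = - (\<Sum>j\<in>{1..m}. all_coeffs u j * dy (f j))"
      by (simp add: del_eq unit_vec_def)
    also have "\<dots> \<in> homog_part (t + n)" by (intro homog_uminus homog_sum y)
    finally show ?thesis using 2 i by (simp add: nth_twists0)
  next
    case 3
    then have "\<not> i < m - 1" by linarith
    with 3 have "del u i = - (\<Sum>j\<in>{1..m}. all_coeffs u j * dz (f j))"
      by (simp add: del_eq unit_vec_def)
    also have "\<dots> \<in> homog_part (t + n)" by (intro homog_uminus homog_sum z)
    finally show ?thesis using \<open>\<not> i < m - 1\<close> i by (simp add: nth_twists0)
  qed
qed

lemma del_irrelevant: "del u k \<in> irrelevant_ideal"
proof -
  note irr = ideal_irrelevant
  have f: "f j \<in> irrelevant_ideal" if "j \<in> {1..m}" for j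
    using homog_irrelevant[OF deg e_pos] that by simp
  have yz: "dy (f j) \<in> irrelevant_ideal \<and> dz (f j) \<in> irrelevant_ideal" if "j \<in> {1..m}" for j
  proof (cases "j = 1")
    case True
    then show ?thesis using ideal_0[OF irr] by (simp add: f1)
  next
    case False
    then have "e j \<ge> 2" using that e_ge by simp
    then have "int (e j) - 1 = int (e j - 1)" "e j - 1 \<ge> 1" by auto
    then show ?thesis
      using homog_dy[OF deg[OF that]] homog_dz[OF deg[OF that]] homog_irrelevant by metis
  qed
  have "(if k < m - 1 then all_coeffs u (Suc k) * f (Suc k) - all_coeffs u m * f m else 0) \<in> irrelevant_ideal"
    using ideal_0[OF irr] m_ge by (auto intro!: ideal_diff[OF irr] ideal_mult[OF irr] f)
  moreover have "unit_vec l k * (\<Sum>j\<in>{1..m}. all_coeffs u j * dy (f j)) \<in> irrelevant_ideal"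
    "unit_vec l k * (\<Sum>j\<in>{1..m}. all_coeffs u j * dz (f j)) \<in> irrelevant_ideal" for l
    using yz by (auto intro!: ideal_mult[OF irr] ideal_sum[OF irr])
  ultimately have "(if k < m - 1 then all_coeffs u (Suc k) * f (Suc k) - all_coeffs u m * f m else 0)
      - unit_vec (m - 1) k * (\<Sum>j\<in>{1..m}. all_coeffs u j * dy (f j))
      - unit_vec m k * (\<Sum>j\<in>{1..m}. all_coeffs u j * dz (f j)) \<in> irrelevant_ideal"
    by (intro ideal_diff[OF irr])
  then show ?thesis by (simp add: del_eq mult.commute)
qed

section \<open>The resolution of the syzygy module\<close>

definition syz_diff :: "nat \<Rightarrow> (nat \<Rightarrow> poly3) \<Rightarrow> nat \<Rightarrow> poly3" where
  "syz_diff i = (if i = 0 then del else (\<lambda>_. 0))"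

lemma graded_hom_del:
  "s = t + 1 \<Longrightarrow> graded_hom (free_module (twists1 m e s)) (free_module (twists0 m s t)) del"
  by (intro graded_hom_free_vecs del.module_hom_axioms)
    (auto simp: del_free simp del: free_module_simps intro: del_graded)

lemma ker_del: "{u \<in> free_vecs (m - 1). del u = 0} = {0}"
  using del_inj by auto

lemma ker_eps: "{v \<in> free_vecs (Suc m). eps v = 0} = del ` free_vecs (m - 1)"
  using relations by (auto simp: del_free eps_del)

theorem syzygy_resolution:
  assumes s: "s = - int d + 2" and t: "t = - int d + 1"
  shows "minimal_graded_free_resolution (D0 F) [twists0 m s t, twists1 m e s] eps syz_diff"
proof -
  let ?Fs = "[twists0 m s t, twists1 m e s]"
  have r: "res_term ?Fs 0 = free_module (twists0 m s t)"
    "res_term ?Fs (Suc 0) = free_module (twists1 m e s)"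
    "res_term ?Fs (Suc (Suc i)) = free_module []" for i
    by (simp_all add: res_term_def)
  have "graded_hom (free_module (twists0 m s t)) (D0 F) eps"
    unfolding graded_hom_def
  proof (intro conjI allI ballI)
    show "eps \<in> carrier (free_module (twists0 m s t)) \<rightarrow> carrier (D0 F)"
      using generators by auto
    show "eps ` graded_part (free_module (twists0 m s t)) n \<subseteq> graded_part (D0 F) n" for n
    proof
      fix \<theta> assume "\<theta> \<in> eps ` graded_part (free_module (twists0 m s t)) n"
      then obtain v where v: "\<theta> = eps v" "v \<in> graded_part (free_module (twists0 m s t)) n" by blast
      have "\<theta> \<in> form_part n" using eps_graded[OF v(2)] v(1) by (simp add: s t)
      moreover have "\<theta> \<in> eps ` free_vecs (Suc m)" using v by simp
      ultimately show "\<theta> \<in> graded_part (D0 F) n" unfolding generators by simp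
    qed
  qed (simp_all add: eps.add eps.scale)
  moreover have "graded_hom (res_term ?Fs (Suc i)) (res_term ?Fs i) (syz_diff i)" for i
  proof (cases i)
    case 0
    have "s = t + 1" by (simp add: s t)
    from graded_hom_del[OF this] show ?thesis unfolding 0 r syz_diff_def by simp
  next
    case (Suc k)
    have "syz_diff i = (\<lambda>_. 0)" by (simp add: syz_diff_def Suc)
    then show ?thesis unfolding Suc r by (simp only: res_term_def graded_hom_zero)
  qed
  moreover have "ker_on (res_term ?Fs (Suc i)) (res_term ?Fs i) (syz_diff i)
      = syz_diff (Suc i) ` carrier (res_term ?Fs (Suc (Suc i)))" for i
    by (cases i; cases "i - 1") (auto simp: res_term_def syz_diff_def ker_on_def dest: del_inj simp del: One_nat_def)
  moreover have "syz_diff i v k \<in> irrelevant_ideal" for i v k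
    by (simp add: syz_diff_def del_irrelevant ideal_0[OF ideal_irrelevant])
  ultimately show ?thesis
    unfolding minimal_graded_free_resolution_def graded_free_resolution_def
    by (simp add: r ker_on_def ker_eps generators) (simp add: syz_diff_def)
qed

section \<open>The resolution of the Jacobian algebra\<close>

definition jac :: "(nat \<Rightarrow> poly3) \<Rightarrow> nat \<Rightarrow> poly3" where
  "jac v = (\<lambda>i. if i = 0 then pairing (v 0, v 1, v 2) (ext_d F) else 0)"

definition milnor_diff :: "nat \<Rightarrow> (nat \<Rightarrow> poly3) \<Rightarrow> nat \<Rightarrow> poly3" where
  "milnor_diff i = (if i = 0 then jac else if i = 1 then form_vec \<circ> eps else if i = 2 then del else (\<lambda>_. 0))"

definition milnor_aug :: "(nat \<Rightarrow> poly3) \<Rightarrow> poly3 set" where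
  "milnor_aug v = jacobian_ideal F +>\<^bsub>S_ring\<^esub> v 0"

sublocale jac: module_hom vec_smult vec_smult jac
  by unfold_locales (auto simp: jac_def fun_eq_iff pairing_def ext_d_def algebra_simps)

lemma module_hom_form_vec_eps: "module_hom vec_smult vec_smult (form_vec \<circ> eps)"
  by unfold_locales (simp_all add: eps.add eps.scale form_vec.add form_vec.scale)

lemma ideal_jacobian: "ideal (jacobian_ideal F) S_ring"
proof -
  interpret cring S_ring by (rule cring_S_ring)
  show ?thesis unfolding jacobian_ideal_def by (rule genideal_ideal) simp
qed

text \<open>
  In this form, the first syzygies of the ideal are visibly the elements of \<open>D_0(F)\<close>.
\<close>

lemma jacobian_ideal_eq: "jacobian_ideal F = range (\<lambda>\<alpha>. pairing \<alpha> (ext_d F))" (is "_ = ?R")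
proof
  interpret cring S_ring by (rule cring_S_ring)
  have R: "ideal ?R S_ring"
    unfolding ideal_S_ring_iff
  proof (intro conjI ballI allI)
    show "0 \<in> ?R" by (rule range_eqI[of _ _ 0]) simp
    show "a + b \<in> ?R" if "a \<in> ?R" "b \<in> ?R" for a b
      using that by (auto simp only: simp flip: pairing_add_left)
    show "r * a \<in> ?R" if "a \<in> ?R" for r a
      using that by (auto simp only: simp flip: pairing_smult_left)
  qed
  have "dx F = pairing (1, 0, 0) (ext_d F)" "dy F = pairing (0, 1, 0) (ext_d F)"
    "dz F = pairing (0, 0, 1) (ext_d F)"
    by (simp_all add: pairing_def ext_d_def)
  then have "{dx F, dy F, dz F} \<subseteq> ?R" by blast
  then show "jacobian_ideal F \<subseteq> ?R"
    unfolding jacobian_ideal_def by (intro genideal_minimal R)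
  have "{dx F, dy F, dz F} \<subseteq> jacobian_ideal F"
    unfolding jacobian_ideal_def by (rule genideal_self) simp
  then show "?R \<subseteq> jacobian_ideal F"
    by (auto simp: pairing_def ext_d_def
        intro!: ideal_add[OF ideal_jacobian] ideal_mult[OF ideal_jacobian])
qed

lemma coset_eq_ideal_iff: "ideal J S_ring \<Longrightarrow> J +>\<^bsub>S_ring\<^esub> a = J \<longleftrightarrow> a \<in> J"
proof -
  assume J: "ideal J S_ring"
  have c: "J +>\<^bsub>S_ring\<^esub> a = (\<lambda>j. j + a) ` J"
    by (auto simp: a_r_coset_def r_coset_def)
  show ?thesis
  proof
    assume "J +>\<^bsub>S_ring\<^esub> a = J"
    moreover have "0 + a \<in> J +>\<^bsub>S_ring\<^esub> a" unfolding c using ideal_0[OF J] by blast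
    ultimately show "a \<in> J" by simp
  next
    assume a: "a \<in> J"
    have "j \<in> (\<lambda>j. j + a) ` J" if "j \<in> J" for j
      using ideal_diff[OF J that a] by (intro image_eqI[of _ _ "j - a"]) auto
    then show "J +>\<^bsub>S_ring\<^esub> a = J" unfolding c using ideal_add[OF J _ a] by auto
  qed
qed

lemma graded_hom_milnor_aug: "graded_hom (free_module [0]) (milnor_algebra F) milnor_aug"
proof -
  interpret J: ideal "jacobian_ideal F" S_ring by (rule ideal_jacobian)
  have hom: "(+>\<^bsub>S_ring\<^esub>) (jacobian_ideal F) \<in> ring_hom S_ring (S_ring Quot jacobian_ideal F)"
    by (rule J.rcos_ring_hom)
  show ?thesis
    unfolding graded_hom_def
    using ring_hom_closed[OF hom] ring_hom_add[OF hom] ring_hom_mult[OF hom]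
    by (auto simp: milnor_algebra_def Let_def milnor_aug_def)
qed

lemma milnor_aug_surj: "milnor_aug ` free_vecs 1 = carrier (milnor_algebra F)"
proof -
  have "(\<lambda>v. v 0) ` free_vecs 1 = UNIV"
  proof (intro equalityI subset_UNIV subsetI)
    fix a :: poly3
    show "a \<in> (\<lambda>v. v 0) ` free_vecs 1"
      by (rule image_eqI[of _ _ "\<lambda>i. if i = 0 then a else 0"]) (auto simp: free_vecs_def)
  qed
  then have "milnor_aug ` free_vecs 1 = range (\<lambda>a. jacobian_ideal F +>\<^bsub>S_ring\<^esub> a)"
    unfolding milnor_aug_def by (metis image_image)
  then show ?thesis
    by (auto simp: milnor_algebra_def Let_def FactRing_def A_RCOSETS_def RCOSETS_def a_r_coset_def)
qed

lemma zero_milnor: "\<zero>\<^bsub>milnor_algebra F\<^esub> = jacobian_ideal F"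
  by (simp add: milnor_algebra_def Let_def FactRing_def)

lemma ker_milnor_aug: "{v \<in> free_vecs 1. milnor_aug v = jacobian_ideal F} = jac ` free_vecs 3"
proof (intro equalityI subsetI)
  fix v assume "v \<in> {v \<in> free_vecs 1. milnor_aug v = jacobian_ideal F}"
  then have v: "v \<in> free_vecs 1" "v 0 \<in> jacobian_ideal F"
    by (auto simp: milnor_aug_def coset_eq_ideal_iff[OF ideal_jacobian])
  then obtain \<alpha> where "v 0 = pairing \<alpha> (ext_d F)" by (auto simp: jacobian_ideal_eq)
  then have "v = jac (form_vec \<alpha>)" using v(1)
    by (cases \<alpha>) (auto simp: jac_def form_vec_def free_vecs_def fun_eq_iff)
  moreover have "form_vec \<alpha> \<in> free_vecs 3" by (auto simp: form_vec_def free_vecs_def split: prod.split)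
  ultimately show "v \<in> jac ` free_vecs 3" by blast
next
  fix w assume "w \<in> jac ` free_vecs 3"
  then have "w 0 \<in> jacobian_ideal F" "w \<in> free_vecs 1"
    by (auto simp: jacobian_ideal_eq jac_def free_vecs_def)
  then show "w \<in> {v \<in> free_vecs 1. milnor_aug v = jacobian_ideal F}"
    by (simp add: milnor_aug_def coset_eq_ideal_iff[OF ideal_jacobian])
qed

text \<open>
  The point where the resolution of \<open>D_0(F)\<close> is spliced with \<open>S^3 \<rightarrow> S\<close>.
\<close>

lemma ker_jac: "{v \<in> free_vecs 3. jac v = 0} = (form_vec \<circ> eps) ` free_vecs (Suc m)"
proof -
  have "{v \<in> free_vecs 3. jac v = 0} = form_vec ` {\<theta>. pairing \<theta> (ext_d F) = 0}"
  proof (intro equalityI subsetI)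
    fix v assume v: "v \<in> {v \<in> free_vecs 3. jac v = 0}"
    then have "pairing (v 0, v 1, v 2) (ext_d F) = 0"
      by (auto simp: jac_def dest: fun_cong[of _ _ 0])
    moreover have "v i = form_vec (v 0, v 1, v 2) i" for i
    proof (cases "i < 3")
      case True
      then have "i = 0 \<or> i = 1 \<or> i = 2" by auto
      then show ?thesis by (auto simp: form_vec_def)
    next
      case False
      then show ?thesis using v by (simp add: form_vec_def free_vecs_def)
    qed
    then have "v = form_vec (v 0, v 1, v 2)" by blast
    ultimately show "v \<in> form_vec ` {\<theta>. pairing \<theta> (ext_d F) = 0}" by blast
  qed (auto simp: jac_def form_vec_def free_vecs_def fun_eq_iff)
  then show ?thesis unfolding image_comp[symmetric] generators by simp
qed

lemma graded_hom_jac: "t = - int d + 1 \<Longrightarrow> graded_hom (free_module (replicate 3 t)) (free_module [0]) jac"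
proof (rule graded_hom_free_vecs)
  assume t: "t = - int d + 1"
  fix v n i assume v: "v \<in> graded_part (free_module (replicate 3 t)) n" and i: "i < length [0 :: int]"
  have v012: "v 0 \<in> homog_part (t + n)" "v 1 \<in> homog_part (t + n)" "v 2 \<in> homog_part (t + n)"
    using v by auto
  have n: "t + n + (int d - 1) = n" by (simp add: t)
  have "v 0 * dx F + v 1 * dy F + v 2 * dz F \<in> homog_part n"
    using homog_mult[OF v012(1) homog_dx[OF F_homog]] homog_mult[OF v012(2) homog_dy[OF F_homog]]
      homog_mult[OF v012(3) homog_dz[OF F_homog]]
    unfolding n by (intro homog_add)
  then show "jac v i \<in> homog_part ([0] ! i + n)" using i by (simp add: jac_def pairing_def ext_d_def)
qed (auto simp: jac.module_hom_axioms jac_def free_vecs_def)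

lemma graded_hom_form_vec_eps:
  assumes "s = t + 1" "t' = t + int d - 1"
  shows "graded_hom (free_module (twists0 m s t)) (free_module (replicate 3 t')) (form_vec \<circ> eps)"
proof (rule graded_hom_free_vecs[OF module_hom_form_vec_eps])
  show "(form_vec \<circ> eps) v \<in> free_vecs (length (replicate 3 t'))" for v
    by (auto simp: form_vec_def free_vecs_def split: prod.split)
  fix v n i
  assume v: "v \<in> graded_part (free_module (twists0 m s t)) n" and i: "i < length (replicate 3 t')"
  show "(form_vec \<circ> eps) v i \<in> homog_part (replicate 3 t' ! i + n)"
    using eps_graded[OF v assms(1)] i
    by (auto simp: assms(2) form_vec_def form_part_def split: prod.split)
qed

lemma eps_irrelevant: "form_vec (eps v) k \<in> irrelevant_ideal"
proof -
  have F2: "g \<in> irrelevant_ideal" if "g \<in> homog_part (int d - 2) \<or> g \<in> homog_part (int d - 1)" for g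
    using that d_ge homog_irrelevant[of g "d - 2"] homog_irrelevant[of g "d - 1"] by (auto simp: of_nat_diff)
  have "form_vec (form_smult (v i) (gen i)) k \<in> irrelevant_ideal" if "i < Suc m" for i
    using gen_homog[OF that] F2 ideal_0[OF ideal_irrelevant]
    by (cases "gen i")
      (auto simp: form_part_def form_vec_def form_smult_def split: if_splits
        intro!: ideal_mult[OF ideal_irrelevant])
  then show ?thesis
    unfolding eps_def form_vec.sum sum_apply by (intro ideal_sum[OF ideal_irrelevant]) auto
qed

lemma jac_irrelevant: "jac v k \<in> irrelevant_ideal"
proof -
  have "g \<in> irrelevant_ideal" if "g \<in> homog_part (int d - 1)" for g
    using that d_ge homog_irrelevant[of g "d - 1"] by (auto simp: of_nat_diff)
  then have "dx F \<in> irrelevant_ideal" "dy F \<in> irrelevant_ideal" "dz F \<in> irrelevant_ideal"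
    using homog_dx[OF F_homog] homog_dy[OF F_homog] homog_dz[OF F_homog] by blast+
  then show ?thesis
    using ideal_0[OF ideal_irrelevant]
    by (auto simp: jac_def pairing_def ext_d_def
        intro!: ideal_add[OF ideal_irrelevant] ideal_mult[OF ideal_irrelevant])
qed

theorem milnor_resolution:
  assumes s: "s = - 2 * int d + 3" and t: "t = - 2 * int d + 2" and t': "t' = - int d + 1"
  shows "minimal_graded_free_resolution (milnor_algebra F)
    [[0], replicate 3 t', twists0 m s t, twists1 m e s] milnor_aug milnor_diff"
proof -
  let ?Fs = "[[0], replicate 3 t', twists0 m s t, twists1 m e s]"
  have r: "res_term ?Fs 0 = free_module [0]" "res_term ?Fs (Suc 0) = free_module (replicate 3 t')"
    "res_term ?Fs (Suc (Suc 0)) = free_module (twists0 m s t)"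
    "res_term ?Fs (Suc (Suc (Suc 0))) = free_module (twists1 m e s)"
    "res_term ?Fs (Suc (Suc (Suc (Suc i)))) = free_module []" for i
    by (simp_all add: res_term_def)
  have \<delta>: "milnor_diff 0 = jac" "milnor_diff (Suc 0) = form_vec \<circ> eps"
    "milnor_diff (Suc (Suc 0)) = del" "milnor_diff (Suc (Suc (Suc i))) = (\<lambda>_. 0)" for i
    by (simp_all add: milnor_diff_def)
  have nat_cases4: "P i" if "P 0" "P (Suc 0)" "P (Suc (Suc 0))" "\<And>i. P (Suc (Suc (Suc i)))" for P and i :: nat
    using that by (metis nat.exhaust)
  have "graded_hom (res_term ?Fs (Suc i)) (res_term ?Fs i) (milnor_diff i)" for i
  proof (rule nat_cases4[of _ i]; unfold r \<delta>)
    have st: "s = t + 1" "t' = t + int d - 1" by (simp_all add: s t t')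
    show "graded_hom (free_module (replicate 3 t')) (free_module [0]) jac"
      by (rule graded_hom_jac[OF t'])
    show "graded_hom (free_module (twists0 m s t)) (free_module (replicate 3 t')) (form_vec \<circ> eps)"
      by (rule graded_hom_form_vec_eps[OF st])
    show "graded_hom (free_module (twists1 m e s)) (free_module (twists0 m s t)) del"
      by (rule graded_hom_del[OF st(1)])
    show "graded_hom (free_module []) (res_term ?Fs (Suc (Suc (Suc k)))) (\<lambda>_. 0)" for k
      unfolding res_term_def by (rule graded_hom_zero)
  qed
  moreover have "ker_on (res_term ?Fs (Suc i)) (res_term ?Fs i) (milnor_diff i)
      = milnor_diff (Suc i) ` carrier (res_term ?Fs (Suc (Suc i)))" for i
  proof (rule nat_cases4[of _ i]; unfold r \<delta> ker_on_def)
    have "form_vec (eps v) = 0 \<longleftrightarrow> eps v = 0" for v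
      using form_vec_inj[of "eps v" 0] by (simp add: form_vec.zero)
    then show "{v \<in> carrier (free_module (twists0 m s t)). (form_vec \<circ> eps) v = \<zero>\<^bsub>free_module (replicate 3 t')\<^esub>}
        = del ` carrier (free_module (twists1 m e s))"
      using ker_eps by simp
    show "{v \<in> carrier (free_module (replicate 3 t')). jac v = \<zero>\<^bsub>free_module [0]\<^esub>}
        = (form_vec \<circ> eps) ` carrier (free_module (twists0 m s t))"
      using ker_jac by simp
    show "{v \<in> carrier (free_module (twists1 m e s)). del v = \<zero>\<^bsub>free_module (twists0 m s t)\<^esub>}
        = (\<lambda>_. 0) ` carrier (free_module [])"
      using ker_del by (simp del: One_nat_def)
    show "{v \<in> carrier (free_module []). (\<lambda>_. 0) v = \<zero>\<^bsub>res_term ?Fs (Suc (Suc (Suc k)))\<^esub>}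
        = (\<lambda>_. 0) ` carrier (free_module [])" for k
      by (simp add: res_term_def)
  qed
  moreover have "milnor_diff i v k \<in> irrelevant_ideal" for i v k
    by (rule nat_cases4[of _ i]; unfold \<delta>)
      (simp_all add: del_irrelevant jac_irrelevant eps_irrelevant ideal_0[OF ideal_irrelevant])
  ultimately show ?thesis
    unfolding minimal_graded_free_resolution_def graded_free_resolution_def
    using graded_hom_milnor_aug milnor_aug_surj ker_milnor_aug
    by (simp add: r \<delta> ker_on_def zero_milnor)
qed

end

theorem theorem1p4:
  fixes m d :: nat and f :: "nat \<Rightarrow> poly3" and e :: "nat \<Rightarrow> nat" and F :: poly3
  assumes m: "m \<ge> 4"
    and deg: "\<And>j. j \<in> {1..m} \<Longrightarrow> f j \<in> homog_part (int (e j))"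
    and irred: "\<And>j. j \<in> {1..m} \<Longrightarrow> irreducible (f j)"
    and smooth: "\<And>j. j \<in> {1..m} \<Longrightarrow> smooth_curve (f j)"
    and distinct: "inj_on (\<lambda>j. curve (f j)) {1..m}"
    and nc: "normal_crossing {1..m} f"
    and one_line: "\<exists>!j. j \<in> {1..m} \<and> e j = 1"
    and f1: "f 1 = X"
    and F: "F = (\<Prod>j\<in>{1..m}. f j)"
    and d: "d = (\<Sum>j\<in>{1..m}. e j)"
  shows
    "(\<exists>\<epsilon> \<delta>.
        minimal_graded_free_resolution (D0 F)
          [replicate (m - 1) (- int d + 2) @ replicate 2 (- int d + 1),
           map (\<lambda>j. - int d + 2 - int (e j)) [2..<Suc m]]
          \<epsilon> \<delta> \<and>
        (\<forall>j\<in>{1..m - 1}. \<epsilon> (unit_vec (j - 1)) = omega m f j) \<and>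
        \<epsilon> (unit_vec (m - 1)) = omega_y F \<and>
        \<epsilon> (unit_vec m) = omega_z F \<and>
        (\<forall>j\<in>{2..m}. \<delta> 0 (unit_vec (j - 2)) = rho m f j)) \<and>
     (\<exists>\<epsilon> \<delta>.
        minimal_graded_free_resolution (milnor_algebra F)
          [[0],
           replicate 3 (- int d + 1),
           replicate (m - 1) (- 2 * int d + 3) @ replicate 2 (- 2 * int d + 2),
           map (\<lambda>j. - 2 * int d + 3 - int (e j)) [2..<Suc m]]
          \<epsilon> \<delta>) \<and>
     (\<forall>j\<in>{2..m}.
        form_smult (f j) (omega_subst m f j)
          - (form_smult (X * dx (f j)) (omega m f 1)
             + form_smult (dy (f j)) (omega_y F)
             + form_smult (dz (f j)) (omega_z F)) = 0)"
proof -
  interpret C: nc_curves m f e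
    using deg irred smooth distinct nc m by unfold_locales auto
  interpret C: nc_curves_line m f e
    using f1 m by unfold_locales auto
  have e1: "e 1 = 1"
    using homog_degree_unique[of X "int (e 1)" 1] deg[of 1] homog_X m by (simp add: f1)
  interpret C: nc_curves_one_line m f e
  proof
    fix j assume j: "j \<in> {2..m}"
    then have "j \<in> {1..m}" "j \<noteq> 1" "1 \<in> {1..m}" using m by auto
    then have "e j \<noteq> 1" using one_line e1 by blast
    moreover have "e j \<ge> 1" using \<open>j \<in> {1..m}\<close> by (rule C.e_pos)
    ultimately show "e j \<ge> 2" by simp
  qed
  have eqs: "F = C.F" "d = C.d" by (simp_all add: F d C.F_def C.d_def)
  have res: "minimal_graded_free_resolution (D0 F)
      [replicate (m - 1) (- int d + 2) @ replicate 2 (- int d + 1),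
       map (\<lambda>j. - int d + 2 - int (e j)) [2..<Suc m]] C.eps C.syz_diff"
    using C.syzygy_resolution[OF refl refl] unfolding eqs twists0_def twists1_def .
  have om: "\<forall>j\<in>{1..m - 1}. C.eps (unit_vec (j - 1)) = omega m f j"
  proof
    fix j assume "j \<in> {1..m - 1}"
    then have "j - 1 < m - 1" "Suc (j - 1) = j" "j - 1 \<le> m" by auto
    then show "C.eps (unit_vec (j - 1)) = omega m f j" by (simp only: C.eps_unit_vec C.gen_def if_True)
  qed
  have yz: "C.eps (unit_vec (m - 1)) = omega_y F" "C.eps (unit_vec m) = omega_z F"
    unfolding eqs using C.eps_unit_vec[of "m - 1"] C.eps_unit_vec[of m] by (simp_all only: C.gen_last)
  have rh: "\<forall>j\<in>{2..m}. C.syz_diff 0 (unit_vec (j - 2)) = rho m f j"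
    by (simp add: C.syz_diff_def C.del_unit_vec)
  have mil: "minimal_graded_free_resolution (milnor_algebra F)
      [[0], replicate 3 (- int d + 1),
       replicate (m - 1) (- 2 * int d + 3) @ replicate 2 (- 2 * int d + 2),
       map (\<lambda>j. - 2 * int d + 3 - int (e j)) [2..<Suc m]] C.milnor_aug C.milnor_diff"
    using C.milnor_resolution[OF refl refl refl] unfolding eqs twists0_def twists1_def .
  have rel: "\<forall>j\<in>{2..m}. form_smult (f j) (omega_subst m f j)
          - (form_smult (X * dx (f j)) (omega m f 1)
             + form_smult (dy (f j)) (omega_y F)
             + form_smult (dz (f j)) (omega_z F)) = 0"
    unfolding eqs using C.omega_subst_eq C.omega_relation by auto
  show ?thesis
    by (rule conjI, rule exI[of _ C.eps], rule exI[of _ C.syz_diff],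
        rule conjI[OF res conjI[OF om conjI[OF yz(1) conjI[OF yz(2) rh]]]],
        rule conjI, rule exI, rule exI, rule mil, rule rel)
qed

end
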